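(* Let $\delta>0$ and $f\in L^2(\Omega)$ be fixed, and let $p=1$. Then the non-local compliance minimization problem $$\text{minimize } \ell(u)\quad\text{over }(\rho,u)\in\mathcal{A}^\delta\times\mathcal{U}_0^\delta\quad\text{subject to}\quad a_{\delta,\kappa}(u,v)=\ell(v)\ \ \forall v\in\mathcal{U}_0^\delta,\quad \kappa(x,x')=\rho^{p/2}(x)\rho^{p/2}(x'),$$ admits an optimal solution $(\rho^*,u^* )\in\mathcal{A}^\delta\times\mathcal{U}_0^\delta$.
   Context: $\Omega\subset\mathbb{R}^n$, $n\ge2$, is open, bounded and connected. For $\delta>0$, $B(x,\delta)$ is the open ball, and $\Omega_\delta=\bigcup_{x\in\Omega}B(x,\delta)$. Kernel: for every $\delta>0$, $A_\delta:\mathbb{R}_+\to\mathbb{R}_+$ satisfies $\frac1n\int_{\mathbb{R}^n}A_\delta(|x|)\,dx=1$ and $\operatorname{supp}A_\delta(|\cdot|)\subset B(0,\delta)$, and there exist $s\in(0,1)$ and $c_\delta>0$ such that $A_\delta(|x|)\ge c_\delta|x|^{-(n+2s-2)}$ for all $x\in B(0,\delta/2)\setminus\{0\}$, $\delta>0$. Bilinear form: for symmetric $\kappa\in L^\infty(\Omega_\delta\times\Omega_\delta)$ bounded between two positive constants, $$a_{\delta,\kappa}(u,v)=\int_{\Omega_\delta}\int_{\Omega_\delta}\kappa(x,x')A_\delta(|x-x'|)\frac{u(x)-u(x')}{|x-x'|}\frac{v(x)-v(x')}{|x-x'|}\,dx\,dx'.$$ Linear functional: $\ell(v)=\int_\Omega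 f(x)v(x)\,dx$. Spaces: $\mathcal{U}^\delta=\{u\in L^2(\Omega_\delta): a_{\delta,1}(u,u)<\infty\}$; $\mathcal{U}_0^\delta$ is the closure of $C_c^\infty(\Omega)$ (functions extended by $0$ outside $\Omega$) in $\mathcal{U}^\delta$ with respect to the norm $(\|u\|_{L^2(\Omega_\delta)}^2+a_{\delta,1}(u,u))^{1/2}$; its elements vanish a.e. in $\Omega_\delta\setminus\Omega$. The form $a_{\delta,1}$ is an inner product making $\mathcal{U}_0^\delta$ a Hilbert space. Admissible designs: given constants $0<\underline\rho<\overline\rho<\infty$ and $\gamma\in(\underline\rho,\overline\rho)$, $$\mathcal{A}^\delta=\Big\{\rho\in L^\infty(\Omega_\delta):\ \underline\rho\le\rho\le\overline\rho\ \text{a.e. in }\Omega_\delta,\ \int_\Omega\rho\,dx\le\gamma|\Omega|\Big\}.$$ An optimal solution is a feasible pair (i.e. one satisfying the constraint) whose objective value is no larger than that of any other feasible pair. *)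

theory Defs
  imports "HOL-Analysis.Analysis"
begin

text \<open>
  Function spaces are sets of representatives: a member of a space of functions on
  \<open>S\<close> is a total function of which only the restriction to \<open>S\<close>, up to Lebesgue null
  sets, matters.
\<close>

definition L2_on :: "'a::euclidean_space set \<Rightarrow> ('a \<Rightarrow> real) set" where
  "L2_on S = {u \<in> borel_measurable (lebesgue_on S).
                integrable (lebesgue_on S) (\<lambda>x. (u x)\<^sup>2)}"

definition Linfty_on :: "'a::euclidean_space set \<Rightarrow> ('a \<Rightarrow> real) set" where
  "Linfty_on S = {u \<in> borel_measurable (lebesgue_on S).
                    \<exists>C. AE x in lebesgue_on S. \<bar>u x\<bar> \<le> C}"

definition L2_norm_on :: "'a::euclidean_space set \<Rightarrow> ('a \<Rightarrow> real) \<Rightarrow> real" where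
  "L2_norm_on S u = sqrt (LINT x|lebesgue_on S. (u x)\<^sup>2)"

primrec Ck :: "nat \<Rightarrow> ('a::euclidean_space \<Rightarrow> real) \<Rightarrow> bool" where
  "Ck 0 g \<longleftrightarrow> continuous_on UNIV g"
| "Ck (Suc k) g \<longleftrightarrow> g differentiable_on UNIV \<and>
     (\<forall>i\<in>Basis. Ck k (\<lambda>x. frechet_derivative g (at x) i))"

text \<open>The functions in \<open>C\<^sub>c\<^sup>\<infinity>(\<Omega>)\<close>, already extended by zero outside \<open>\<Omega>\<close>.\<close>

definition test_functions :: "'a::euclidean_space set \<Rightarrow> ('a \<Rightarrow> real) set" where
  "test_functions \<Omega> = {\<phi>. (\<forall>k. Ck k \<phi>) \<and>
      compact (closure {x. \<phi> x \<noteq> 0}) \<and> closure {x. \<phi> x \<noteq> 0} \<subseteq> \<Omega>}"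

definition enlarge :: "real \<Rightarrow> 'a::euclidean_space set \<Rightarrow> 'a set" where
  "enlarge \<delta> \<Omega> = (\<Union>x\<in>\<Omega>. ball x \<delta>)"

text \<open>
  In the following, \<open>K\<close> is the kernel profile \<open>A\<^sub>\<delta>\<close> for the \<open>\<delta>\<close> at hand. On the diagonal,
  a Lebesgue null set, the quotients are \<open>0 / 0 = 0\<close>.
\<close>

definition form_integrand ::
  "(real \<Rightarrow> real) \<Rightarrow> ('a::euclidean_space \<Rightarrow> 'a \<Rightarrow> real) \<Rightarrow> ('a \<Rightarrow> real) \<Rightarrow> ('a \<Rightarrow> real)
     \<Rightarrow> 'a \<times> 'a \<Rightarrow> real" where
  "form_integrand K \<kappa> u v = (\<lambda>(x, x'). \<kappa> x x' * K (norm (x - x')) *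
      ((u x - u x') / norm (x - x')) * ((v x - v x') / norm (x - x')))"

definition nonlocal_form ::
  "(real \<Rightarrow> real) \<Rightarrow> real \<Rightarrow> 'a::euclidean_space set \<Rightarrow> ('a \<Rightarrow> 'a \<Rightarrow> real)
     \<Rightarrow> ('a \<Rightarrow> real) \<Rightarrow> ('a \<Rightarrow> real) \<Rightarrow> real" where
  "nonlocal_form K \<delta> \<Omega> \<kappa> u v =
     (LINT z|lebesgue_on (enlarge \<delta> \<Omega> \<times> enlarge \<delta> \<Omega>). form_integrand K \<kappa> u v z)"

text \<open>
  For a nonnegative kernel the integrand of \<open>a\<^sub>\<delta>\<^sub>,\<^sub>1(u, u)\<close> is nonnegative, so that
  \<open>a\<^sub>\<delta>\<^sub>,\<^sub>1(u, u) < \<infinity>\<close> is integrability. It has to be required explicitly, because the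
  Bochner integral of a nonintegrable function is \<open>0\<close>.
\<close>

definition energy_space ::
  "(real \<Rightarrow> real) \<Rightarrow> real \<Rightarrow> 'a::euclidean_space set \<Rightarrow> ('a \<Rightarrow> real) set" where
  "energy_space K \<delta> \<Omega> = {u \<in> L2_on (enlarge \<delta> \<Omega>).
     integrable (lebesgue_on (enlarge \<delta> \<Omega> \<times> enlarge \<delta> \<Omega>))
       (form_integrand K (\<lambda>_ _. 1) u u)}"

definition energy_norm ::
  "(real \<Rightarrow> real) \<Rightarrow> real \<Rightarrow> 'a::euclidean_space set \<Rightarrow> ('a \<Rightarrow> real) \<Rightarrow> real" where
  "energy_norm K \<delta> \<Omega> u =
     sqrt ((L2_norm_on (enlarge \<delta> \<Omega>) u)\<^sup>2 + nonlocal_form K \<delta> \<Omega> (\<lambda>_ _. 1) u u)"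

definition energy_space_0 ::
  "(real \<Rightarrow> real) \<Rightarrow> real \<Rightarrow> 'a::euclidean_space set \<Rightarrow> ('a \<Rightarrow> real) set" where
  "energy_space_0 K \<delta> \<Omega> = {u \<in> energy_space K \<delta> \<Omega>.
     \<forall>\<epsilon>>0. \<exists>\<phi>\<in>test_functions \<Omega>. energy_norm K \<delta> \<Omega> (\<lambda>x. u x - \<phi> x) < \<epsilon>}"

definition load :: "'a::euclidean_space set \<Rightarrow> ('a \<Rightarrow> real) \<Rightarrow> ('a \<Rightarrow> real) \<Rightarrow> real" where
  "load \<Omega> f v = (LINT x|lebesgue_on \<Omega>. f x * v x)"

definition admissible_designs ::
  "real \<Rightarrow> 'a::euclidean_space set \<Rightarrow> real \<Rightarrow> real \<Rightarrow> real \<Rightarrow> ('a \<Rightarrow> real) set" where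
  "admissible_designs \<delta> \<Omega> \<rho>lo \<rho>hi \<gamma> = {\<rho> \<in> Linfty_on (enlarge \<delta> \<Omega>).
     (AE x in lebesgue_on (enlarge \<delta> \<Omega>). \<rho>lo \<le> \<rho> x \<and> \<rho> x \<le> \<rho>hi) \<and>
     (LINT x|lebesgue_on \<Omega>. \<rho> x) \<le> \<gamma> * measure lebesgue \<Omega>}"

definition design_coefficient :: "real \<Rightarrow> ('a \<Rightarrow> real) \<Rightarrow> 'a \<Rightarrow> 'a \<Rightarrow> real" where
  "design_coefficient p \<rho> x x' = \<rho> x powr (p / 2) * \<rho> x' powr (p / 2)"

definition feasible_pairs ::
  "(real \<Rightarrow> real) \<Rightarrow> real \<Rightarrow> 'a::euclidean_space set \<Rightarrow> ('a \<Rightarrow> real) \<Rightarrow> real \<Rightarrow> real \<Rightarrow> real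
     \<Rightarrow> real \<Rightarrow> (('a \<Rightarrow> real) \<times> ('a \<Rightarrow> real)) set" where
  "feasible_pairs K \<delta> \<Omega> f p \<rho>lo \<rho>hi \<gamma> =
     {(\<rho>, u). \<rho> \<in> admissible_designs \<delta> \<Omega> \<rho>lo \<rho>hi \<gamma> \<and> u \<in> energy_space_0 K \<delta> \<Omega> \<and>
        (\<forall>v\<in>energy_space_0 K \<delta> \<Omega>.
           nonlocal_form K \<delta> \<Omega> (design_coefficient p \<rho>) u v = load \<Omega> f v)}"

definition optimal_solution ::
  "(real \<Rightarrow> real) \<Rightarrow> real \<Rightarrow> 'a::euclidean_space set \<Rightarrow> ('a \<Rightarrow> real) \<Rightarrow> real \<Rightarrow> real \<Rightarrow> real
     \<Rightarrow> real \<Rightarrow> ('a \<Rightarrow> real) \<Rightarrow> ('a \<Rightarrow> real) \<Rightarrow> bool" where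
  "optimal_solution K \<delta> \<Omega> f p \<rho>lo \<rho>hi \<gamma> \<rho> u \<longleftrightarrow>
     (\<rho>, u) \<in> feasible_pairs K \<delta> \<Omega> f p \<rho>lo \<rho>hi \<gamma> \<and>
     (\<forall>(\<rho>', u')\<in>feasible_pairs K \<delta> \<Omega> f p \<rho>lo \<rho>hi \<gamma>. load \<Omega> f u \<le> load \<Omega> f u')"

end

theory Submission
  imports Defs
begin

text \<open>
  The compliance of a design is a maximum: if \<open>u\<close> solves the state equation for \<open>\<rho>\<close>, then
  \<open>\<ell>(u)\<close> is the largest value of \<open>2 \<ell>(v) - a\<^sub>\<rho>(v, v)\<close> over all \<open>v\<close>, because the difference
  is \<open>a\<^sub>\<rho>(u - v, u - v)\<close>. For \<open>p = 1\<close> the coefficient \<open>\<surd>\<rho>(x) \<surd>\<rho>(x')\<close> is a geometric mean,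
  hence concave in \<open>\<rho>\<close>. So \<open>a\<^sub>\<rho>(v, v)\<close> is concave in \<open>\<rho>\<close> and the compliance, a supremum of
  convex functions, is convex. Its sublevel sets
  \<open>C\<^sub>t = {\<rho>. \<forall>v. 2 \<ell>(v) - a\<^sub>\<rho>(v, v) \<le> t}\<close> make sense before any state equation is solved. They
  are convex (\<open>compliance_sublevel_midpoint\<close>) and closed under almost everywhere convergence, by
  dominated convergence (\<open>compliance_sublevel_limit\<close>).

  Convexity and strong closedness give a minimizer without weak compactness. Let \<open>m\<close> be the
  infimum of the \<open>t\<close> with \<open>C\<^sub>t\<close> nonempty, and choose in each \<open>C\<^sub>t\<close>, \<open>t = m + 1/k\<close>, an element
  of almost minimal \<open>L\<^sup>2\<close> norm. The parallelogram identity makes this sequence Cauchy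
  (\<open>midpoint_minimizing_sequence\<close>); a subsequence converges almost everywhere, and the limit lies
  in \<open>C\<^sub>m\<close> (\<open>compliance_sublevel_attained\<close>). Every feasible pair \<open>(\<rho>, u)\<close> has
  \<open>\<rho> \<in> C\<^sub>t\<close> for \<open>t = \<ell>(u)\<close>, so that \<open>m \<le> \<ell>(u)\<close>, and the state for the limit design has
  compliance at most \<open>m\<close>.

  That this state exists is the Riesz representation theorem in \<open>\<U>\<^sub>0\<close>
  (\<open>state_equation_solvable\<close>). The same selection principle, applied to \<open>a(v, v) - 2 \<ell>(v)\<close> on
  the constant family \<open>\<U>\<^sub>0\<close>, yields a Cauchy minimizing sequence. Two properties of the energy space
  enter. It is complete (\<open>energy_space_complete\<close>), by an almost everywhere convergent subsequence and
  Fatou's lemma. The form is coercive, by a nonlocal Poincare inequality (\<open>Poincare\<close>): a function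
  vanishing outside the bounded set \<open>\<Omega>\<close> is a telescoping sum of its increments along a
  shift \<open>h\<close>, and the kernel weighs the increments of all \<open>h\<close> in a small ball from below.

  Throughout, the form is written as \<open>\<integral> \<kappa> G(u) G(v)\<close> with the linear operator
  \<open>G(u)(x, x') = \<surd>K(|x - x'|) (u(x) - u(x')) / |x - x'|\<close>, a nonlocal gradient. Finite energy then
  means that \<open>u\<close> and \<open>G(u)\<close> are square integrable, and both summands of the energy norm are
  \<open>L\<^sup>2\<close> norms.
\<close>

section \<open>Pullbacks of Lebesgue measurable functions\<close>

text \<open>
  A Borel map need not be measurable between the completed \<open>\<sigma>\<close>-algebras; it is if preimages of
  null sets are null. This is what allows Lebesgue measurable functions, such as
  the kernel, to be composed with the projections and the difference map on pairs.
\<close>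
lemma null_preserving_lebesgue:
  fixes T :: "'b::euclidean_space \<Rightarrow> 'a::euclidean_space"
  assumes T: "T \<in> borel_measurable borel"
    and null: "\<And>N. N \<in> null_sets lborel \<Longrightarrow> T -` N \<in> null_sets lborel"
  shows "T \<in> lebesgue \<rightarrow>\<^sub>M lebesgue"
    and "(AE x in lebesgue. P x) \<Longrightarrow> (AE z in lebesgue. P (T z))"
proof -
  have Tm: "T \<in> lebesgue \<rightarrow>\<^sub>M lborel"
    using T by (simp add: measurable_completion)
  have "null_sets lborel \<subseteq> null_sets (distr lebesgue lborel T)"
  proof
    fix N :: "'a set" assume N: "N \<in> null_sets lborel"
    then have "T -` N \<in> null_sets lebesgue"
      using null null_sets_completionI by blast
    then show "N \<in> null_sets (distr lebesgue lborel T)"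
      using N Tm by (auto simp: null_sets_def emeasure_distr)
  qed
  then show "T \<in> lebesgue \<rightarrow>\<^sub>M lebesgue"
    using completion.measurable_completion2[OF Tm] by simp
  show "AE z in lebesgue. P (T z)" if "AE x in lebesgue. P x"
  proof -
    from that have "AE x in lborel. P x" by (simp add: AE_completion_iff)
    then obtain N where N: "N \<in> null_sets lborel" "{x. \<not> P x} \<subseteq> N"
      by (auto simp: eventually_ae_filter)
    have "AE z in lborel. P (T z)"
      using N(2) by (intro AE_I'[OF null[OF N(1)]]) auto
    then show ?thesis by (simp add: AE_completion_iff)
  qed
qed

lemma emeasure_lborel_translate:
  fixes N :: "'a::euclidean_space set"
  assumes "N \<in> sets borel"
  shows "emeasure lborel ((\<lambda>x. c + x) -` N) = emeasure lborel N"
proof -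
  have "emeasure lborel N = emeasure (distr lborel borel ((+) c)) N"
    by (simp add: lborel_distr_plus)
  also have "\<dots> = emeasure lborel ((\<lambda>x. c + x) -` N)"
    using assms by (subst emeasure_distr) auto
  finally show ?thesis by simp
qed

lemma nn_integral_lborel_translate:
  fixes g :: "'a::euclidean_space \<Rightarrow> ennreal"
  assumes "g \<in> borel_measurable borel"
  shows "(\<integral>\<^sup>+x. g (c + x) \<partial>lborel) = (\<integral>\<^sup>+x. g x \<partial>lborel)"
proof -
  have "(\<integral>\<^sup>+x. g x \<partial>lborel) = (\<integral>\<^sup>+x. g x \<partial>distr lborel borel ((+) c))"
    by (simp add: lborel_distr_plus)
  also have "\<dots> = (\<integral>\<^sup>+x. g (c + x) \<partial>lborel)"
    using assms by (subst nn_integral_distr) auto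
  finally show ?thesis by simp
qed

lemma null_sets_vimage_fst:
  fixes N :: "'a::euclidean_space set"
  assumes "N \<in> null_sets lborel"
  shows "(fst :: 'a \<times> 'b::euclidean_space \<Rightarrow> 'a) -` N \<in> null_sets lborel"
proof -
  have "N \<times> (UNIV :: 'b set) \<in> null_sets (lborel \<Otimes>\<^sub>M lborel)"
    using assms by (intro lborel.times_in_null_sets1) auto
  moreover have "(fst :: 'a \<times> 'b \<Rightarrow> 'a) -` N = N \<times> UNIV" by auto
  ultimately show ?thesis by (simp add: lborel_prod)
qed

lemma null_sets_vimage_snd:
  fixes N :: "'b::euclidean_space set"
  assumes "N \<in> null_sets lborel"
  shows "(snd :: 'a::euclidean_space \<times> 'b \<Rightarrow> 'b) -` N \<in> null_sets lborel"
proof -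
  have "(UNIV :: 'a set) \<times> N \<in> null_sets (lborel \<Otimes>\<^sub>M lborel)"
    using assms by (intro lborel.times_in_null_sets2) auto
  moreover have "(snd :: 'a \<times> 'b \<Rightarrow> 'b) -` N = UNIV \<times> N" by auto
  ultimately show ?thesis by (simp add: lborel_prod)
qed

text \<open>By Fubini: every slice of the preimage is a translate of the null set.\<close>
lemma null_sets_vimage_diff:
  fixes N :: "'a::euclidean_space set"
  assumes N: "N \<in> null_sets lborel"
  shows "(\<lambda>z. fst z - snd z) -` N \<in> null_sets (lborel :: ('a \<times> 'a) measure)"
proof -
  let ?A = "(\<lambda>z::'a \<times> 'a. fst z - snd z) -` N"
  have Nb: "N \<in> sets borel" using N by (auto simp: null_sets_def)
  have "(\<lambda>z::'a \<times> 'a. fst z - snd z) \<in> borel_measurable borel"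
    by (intro borel_measurable_continuous_onI continuous_intros)
  then have A: "?A \<in> sets borel"
    using measurable_sets[OF _ Nb, of _ borel] by simp
  have "emeasure (lborel \<Otimes>\<^sub>M lborel) ?A =
      (\<integral>\<^sup>+y. emeasure lborel ((\<lambda>x. (x, y)) -` ?A) \<partial>(lborel :: 'a measure))"
    using A by (intro lborel_pair.emeasure_pair_measure_alt2)
      (metis lborel_prod sets_lborel)
  also have "\<dots> = (\<integral>\<^sup>+y. 0 \<partial>(lborel :: 'a measure))"
  proof (rule nn_integral_cong)
    fix y :: 'a
    have "(\<lambda>x. (x, y)) -` ?A = (\<lambda>x. - y + x) -` N" by auto
    then show "emeasure lborel ((\<lambda>x. (x, y)) -` ?A) = 0"
      using emeasure_lborel_translate[OF Nb, of "- y"] N by (simp add: null_sets_def)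
  qed
  finally show ?thesis
    using A by (simp add: null_sets_def lborel_prod)
qed

lemma measurable_diff_lebesgue:
  "(\<lambda>z::'a::euclidean_space \<times> 'a. fst z - snd z) \<in> lebesgue \<rightarrow>\<^sub>M lebesgue"
  by (intro null_preserving_lebesgue(1) null_sets_vimage_diff
      borel_measurable_continuous_onI continuous_intros)

lemma
  fixes S :: "'a::euclidean_space set"
  assumes S: "open S"
  shows measurable_fst_lebesgue_on: "fst \<in> lebesgue_on (S \<times> S) \<rightarrow>\<^sub>M lebesgue_on S"
    and measurable_snd_lebesgue_on: "snd \<in> lebesgue_on (S \<times> S) \<rightarrow>\<^sub>M lebesgue_on S"
    and AE_fst_lebesgue_on:
      "(AE x in lebesgue_on S. P x) \<Longrightarrow> (AE z in lebesgue_on (S \<times> S). P (fst z))"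
    and AE_snd_lebesgue_on:
      "(AE x in lebesgue_on S. P x) \<Longrightarrow> (AE z in lebesgue_on (S \<times> S). P (snd z))"
proof -
  have SS: "S \<in> sets lebesgue" "S \<times> S \<in> sets lebesgue"
    using S by (auto intro!: lmeasurable_open sets_completionI_sets simp: open_Times)
  have fst: "(fst :: 'a \<times> 'a \<Rightarrow> 'a) \<in> borel_measurable borel"
    and snd: "(snd :: 'a \<times> 'a \<Rightarrow> 'a) \<in> borel_measurable borel"
    by (intro borel_measurable_continuous_onI continuous_intros)+
  note F = null_preserving_lebesgue[OF fst null_sets_vimage_fst]
  note G = null_preserving_lebesgue[OF snd null_sets_vimage_snd]
  show "fst \<in> lebesgue_on (S \<times> S) \<rightarrow>\<^sub>M lebesgue_on S"
    by (intro measurable_restrict_space2 measurable_restrict_space1 F(1))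
      (auto simp: space_restrict_space)
  show "snd \<in> lebesgue_on (S \<times> S) \<rightarrow>\<^sub>M lebesgue_on S"
    by (intro measurable_restrict_space2 measurable_restrict_space1 G(1))
      (auto simp: space_restrict_space)
  show "AE z in lebesgue_on (S \<times> S). P (fst z)" if "AE x in lebesgue_on S. P x"
  proof -
    have "AE x in lebesgue. x \<in> S \<longrightarrow> P x"
      using that SS by (simp add: AE_restrict_space_iff)
    from F(2)[OF _ this] show ?thesis
      using SS by (auto simp: AE_restrict_space_iff elim: eventually_mono)
  qed
  show "AE z in lebesgue_on (S \<times> S). P (snd z)" if "AE x in lebesgue_on S. P x"
  proof -
    have "AE x in lebesgue. x \<in> S \<longrightarrow> P x"
      using that SS by (simp add: AE_restrict_space_iff)
    from G(2)[OF _ this] show ?thesis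
      using SS by (auto simp: AE_restrict_space_iff elim: eventually_mono)
  qed
qed

section \<open>Midpoint selection and quadratic inequalities\<close>

text \<open>
  The parallelogram argument behind projections onto closed convex sets, for a decreasing
  family of sets: if the midpoint of \<open>x\<close> and \<open>y\<close> lowers \<open>q\<close> by at least \<open>D x y\<close>, then almost
  minimal elements must be \<open>D\<close>-close. The midpoint of \<open>x j\<close> and \<open>x k\<close> lies in the
  larger of the two sets only, but the infima of \<open>q\<close> over the sets increase and
  converge, so all of them are almost equal for large indices.
\<close>
lemma midpoint_minimizing_sequence:
  fixes C :: "nat \<Rightarrow> 'b set" and q :: "'b \<Rightarrow> real"
    and mid :: "'b \<Rightarrow> 'b \<Rightarrow> 'b" and D :: "'b \<Rightarrow> 'b \<Rightarrow> real"
  assumes decreasing: "\<And>j k. j \<le> k \<Longrightarrow> C k \<subseteq> C j"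
    and lower: "\<And>x. x \<in> C 0 \<Longrightarrow> L \<le> q x"
    and upper: "\<And>k. \<exists>x\<in>C k. q x \<le> B"
    and mid: "\<And>k x y. x \<in> C k \<Longrightarrow> y \<in> C k \<Longrightarrow> mid x y \<in> C k"
    and gap: "\<And>x y. x \<in> C 0 \<Longrightarrow> y \<in> C 0 \<Longrightarrow> D x y \<le> (q x + q y) / 2 - q (mid x y)"
  obtains x where "\<And>k. x k \<in> C k"
    and "\<And>k y. y \<in> C k \<Longrightarrow> q (x k) \<le> q y + 1 / real (Suc k)"
    and "\<And>\<epsilon>. \<epsilon> > 0 \<Longrightarrow> \<exists>N. \<forall>j\<ge>N. \<forall>k\<ge>N. D (x j) (x k) < \<epsilon>"
proof -
  define d where "d k = Inf (q ` C k)" for k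
  have C0: "x \<in> C 0" if "x \<in> C k" for x k
    using decreasing[of 0 k] that by auto
  have bdd: "bdd_below (q ` C k)" for k
    using lower C0 by (intro bdd_belowI2[of _ L]) auto
  have ne: "C k \<noteq> {}" for k using upper[of k] by auto
  have d_le: "d k \<le> q y" if "y \<in> C k" for k y
    unfolding d_def using bdd that by (intro cInf_lower) auto
  have "\<exists>x\<in>C k. q x < d k + 1 / real (Suc k)" for k
    using cInf_lessD[of "q ` C k" "d k + 1 / real (Suc k)"] ne[of k]
    by (auto simp: d_def)
  then obtain x where x: "\<And>k. x k \<in> C k" "\<And>k. q (x k) < d k + 1 / real (Suc k)"
    by metis
  have mono: "incseq d"
    unfolding incseq_def d_def
    using ne bdd by (intro allI impI cInf_superset_mono image_mono decreasing) auto
  have "d k \<le> B" for k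
    using upper[of k] d_le by force
  then have "\<forall>k. d k \<le> B" by blast
  then obtain l where "d \<longlonglongrightarrow> l"
    by (rule incseq_convergent[OF mono])
  then have "convergent d" by (rule convergentI)
  then have Cauchy: "Cauchy d" by (simp add: Cauchy_convergent_iff)
  show ?thesis
  proof
    show "x k \<in> C k" for k by (rule x)
    show "q (x k) \<le> q y + 1 / real (Suc k)" if "y \<in> C k" for k y
      using x(2)[of k] d_le[OF that] by simp
    fix \<epsilon> :: real assume \<epsilon>: "\<epsilon> > 0"
    obtain N1 where N1: "\<And>j k. j \<ge> N1 \<Longrightarrow> k \<ge> N1 \<Longrightarrow> \<bar>d j - d k\<bar> < \<epsilon> / 2"
      using Cauchy \<epsilon> unfolding Cauchy_def dist_real_def by (metis half_gt_zero)
    obtain N2 where N2: "1 / real (Suc N2) < \<epsilon> / 2"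
      using \<epsilon> nat_approx_posE[of "\<epsilon> / 2"] by auto
    show "\<exists>N. \<forall>j\<ge>N. \<forall>k\<ge>N. D (x j) (x k) < \<epsilon>"
    proof (intro exI allI impI)
      fix j k assume jk: "j \<ge> max N1 N2" "k \<ge> max N1 N2"
      define i where "i = min j k"
      have "x j \<in> C i" "x k \<in> C i"
        using x(1)[of j] x(1)[of k] decreasing[of i j] decreasing[of i k]
        by (auto simp: i_def)
      then have "mid (x j) (x k) \<in> C i" by (rule mid)
      then have "D (x j) (x k) \<le> (q (x j) + q (x k)) / 2 - d i"
        using gap[of "x j" "x k"] C0 x(1) d_le by force
      moreover have "\<bar>d j - d i\<bar> < \<epsilon> / 2" "\<bar>d k - d i\<bar> < \<epsilon> / 2"
        using N1[of j i] N1[of k i] jk by (simp_all add: i_def)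
      moreover have "1 / real (Suc j) \<le> 1 / real (Suc N2)" "1 / real (Suc k) \<le> 1 / real (Suc N2)"
        using jk by (auto intro!: divide_left_mono)
      ultimately show "D (x j) (x k) < \<epsilon>"
        using x(2)[of j] x(2)[of k] N2 by argo
    qed
  qed
qed

lemma nonneg_quadratic_discriminant:
  fixes a b e :: real
  assumes "\<And>t. 0 \<le> a * t\<^sup>2 + 2 * b * t + e" and "0 \<le> a"
  shows "b\<^sup>2 \<le> a * e"
proof (cases "a = 0")
  case True
  have e: "0 \<le> e" using assms(1)[of 0] by simp
  have "b = 0"
  proof (rule ccontr)
    assume "b \<noteq> 0"
    then show False using assms(1)[of "- (e + 1) / (2 * b)"] True by simp
  qed
  then show ?thesis using True by simp
next
  case False
  then have a: "a > 0" using assms(2) by simp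
  have "0 \<le> a * (- b / a)\<^sup>2 + 2 * b * (- b / a) + e" by (rule assms(1))
  also have "\<dots> = e - b\<^sup>2 / a" using a by (simp add: field_simps power2_eq_square)
  finally show ?thesis using a by (simp add: field_simps)
qed

text \<open>Here \<open>M\<close> may have any sign; the factor \<open>\<bar>M\<bar> + 1\<close> in the proof avoids a division by zero.\<close>
lemma nonpos_if_le_small_multiples:
  fixes X M :: real
  assumes "\<And>e. e > 0 \<Longrightarrow> X \<le> e * M"
  shows "X \<le> 0"
proof (rule field_le_epsilon)
  fix e :: real assume e: "e > 0"
  have "X \<le> e / (\<bar>M\<bar> + 1) * M" using e by (intro assms) (simp add: add_nonneg_pos)
  also have "\<dots> = e * (M / (\<bar>M\<bar> + 1))" by simp
  also have "\<dots> \<le> e * 1" using e by (intro mult_left_mono) (auto simp: field_simps)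
  finally show "X \<le> 0 + e" by simp
qed

section \<open>Square-integrable functions\<close>

definition sqint :: "'a::euclidean_space set \<Rightarrow> ('a \<Rightarrow> real) \<Rightarrow> real" where
  "sqint S u = (LINT x|lebesgue_on S. (u x)\<^sup>2)"

lemma L2_on_integrable_mult:
  assumes "u \<in> L2_on S" "v \<in> L2_on S"
  shows "integrable (lebesgue_on S) (\<lambda>x. u x * v x)"
proof (rule Bochner_Integration.integrable_bound)
  show "integrable (lebesgue_on S) (\<lambda>x. (u x)\<^sup>2 + (v x)\<^sup>2)"
    using assms by (auto simp: L2_on_def)
  show "(\<lambda>x. u x * v x) \<in> borel_measurable (lebesgue_on S)"
    using assms by (auto simp: L2_on_def)
  have "\<bar>u x * v x\<bar> \<le> (u x)\<^sup>2 + (v x)\<^sup>2" for x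
    using sum_squares_bound[of "\<bar>u x\<bar>" "\<bar>v x\<bar>"] mult_nonneg_nonneg[of "\<bar>u x\<bar>" "\<bar>v x\<bar>"]
    unfolding abs_mult power2_abs by linarith
  then show "AE x in lebesgue_on S. norm (u x * v x) \<le> norm ((u x)\<^sup>2 + (v x)\<^sup>2)"
    by (intro AE_I2) (simp add: order_trans)
qed

lemma
  assumes "u \<in> L2_on S" "v \<in> L2_on S"
  shows L2_on_lincomb: "(\<lambda>x. a * u x + b * v x) \<in> L2_on S"
    and sqint_lincomb: "sqint S (\<lambda>x. a * u x + b * v x) =
      a\<^sup>2 * sqint S u + 2 * a * b * (LINT x|lebesgue_on S. u x * v x) + b\<^sup>2 * sqint S v"
proof -
  have eq: "(\<lambda>x. (a * u x + b * v x)\<^sup>2) =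
      (\<lambda>x. a\<^sup>2 * (u x)\<^sup>2 + 2 * a * b * (u x * v x) + b\<^sup>2 * (v x)\<^sup>2)"
    by (auto simp: power2_eq_square algebra_simps)
  note int = L2_on_integrable_mult[OF assms]
  show "(\<lambda>x. a * u x + b * v x) \<in> L2_on S"
    using assms int unfolding L2_on_def mem_Collect_eq eq by auto
  show "sqint S (\<lambda>x. a * u x + b * v x) =
      a\<^sup>2 * sqint S u + 2 * a * b * (LINT x|lebesgue_on S. u x * v x) + b\<^sup>2 * sqint S v"
    unfolding sqint_def eq using assms int by (simp add: L2_on_def)
qed

lemma L2_on_diff: "u \<in> L2_on S \<Longrightarrow> v \<in> L2_on S \<Longrightarrow> (\<lambda>x. u x - v x) \<in> L2_on S"
  using L2_on_lincomb[of u S v 1 "-1"] by simp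

lemma sqint_nonneg: "0 \<le> sqint S u"
  unfolding sqint_def by (intro integral_nonneg_AE) auto

text \<open>
  The parallelogram law with one square dropped. It replaces the triangle inequality of
  the norm and avoids square roots in all estimates below.
\<close>
lemma sqint_lincomb_le:
  assumes "u \<in> L2_on S" "v \<in> L2_on S"
  shows "sqint S (\<lambda>x. a * u x + b * v x) \<le> 2 * a\<^sup>2 * sqint S u + 2 * b\<^sup>2 * sqint S v"
  using sqint_lincomb[OF assms, of a b] sqint_lincomb[OF assms, of a "-b"]
    sqint_nonneg[of S "\<lambda>x. a * u x + (-b) * v x"] by (simp add: mult.commute)

lemma L2_on_subset:
  assumes u: "u \<in> L2_on T" and "S \<subseteq> T" and S: "S \<in> sets lebesgue" and T: "T \<in> sets lebesgue"
  shows "u \<in> L2_on S" and "sqint S u \<le> sqint T u"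
proof -
  have eq: "lebesgue_on S = restrict_space (lebesgue_on T) S"
    using \<open>S \<subseteq> T\<close> S T by (subst restrict_restrict_space) (auto simp: Int_absorb1)
  have S': "S \<inter> space (lebesgue_on T) \<in> sets (lebesgue_on T)"
    using assms by (auto simp: sets_restrict_space space_restrict_space)
  have int: "integrable (lebesgue_on T) (\<lambda>x. (u x)\<^sup>2)" using u by (simp add: L2_on_def)
  have int2: "integrable (lebesgue_on T) (\<lambda>x. indicator S x *\<^sub>R (u x)\<^sup>2)"
    using S' int \<open>S \<subseteq> T\<close> \<open>S \<in> sets lebesgue\<close> T
    by (intro integrable_mult_indicator) (auto simp: sets_restrict_space_iff)
  show "u \<in> L2_on S"
    unfolding L2_on_def mem_Collect_eq eq integrable_restrict_space[OF S']
    using u int2 by (auto simp: L2_on_def measurable_restrict_space1)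
  have "sqint S u = (LINT x|lebesgue_on T. indicator S x *\<^sub>R (u x)\<^sup>2)"
    unfolding eq sqint_def by (rule integral_restrict_space[OF S'])
  also have "\<dots> \<le> sqint T u"
    unfolding sqint_def by (intro integral_mono int int2) (auto simp: indicator_def)
  finally show "sqint S u \<le> sqint T u" .
qed

lemma L2_on_Fatou:
  fixes f :: "nat \<Rightarrow> 'a::euclidean_space \<Rightarrow> real"
  assumes f: "\<And>j. f j \<in> L2_on S"
    and bound: "\<And>j. j \<ge> N \<Longrightarrow> sqint S (f j) \<le> B"
    and g: "g \<in> borel_measurable (lebesgue_on S)"
    and lim: "AE x in lebesgue_on S. (\<lambda>j. f j x) \<longlonglongrightarrow> g x"
  shows "g \<in> L2_on S" and "sqint S g \<le> B"
proof -
  let ?M = "lebesgue_on S"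
  have B: "0 \<le> B" using bound[of N] sqint_nonneg[of S "f N"] by linarith
  have fm[measurable]: "f j \<in> borel_measurable ?M" for j using f by (simp add: L2_on_def)
  note [measurable] = g
  have nn: "(\<integral>\<^sup>+x. ennreal ((f j x)\<^sup>2) \<partial>?M) = ennreal (sqint S (f j))" for j
    using f[of j] unfolding sqint_def by (intro nn_integral_eq_integral) (auto simp: L2_on_def)
  have "(\<integral>\<^sup>+x. ennreal ((g x)\<^sup>2) \<partial>?M) = (\<integral>\<^sup>+x. liminf (\<lambda>j. ennreal ((f j x)\<^sup>2)) \<partial>?M)"
  proof (rule nn_integral_cong_AE)
    show "AE x in ?M. ennreal ((g x)\<^sup>2) = liminf (\<lambda>j. ennreal ((f j x)\<^sup>2))"
      using lim
    proof eventually_elim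
      case (elim x)
      then have "(\<lambda>j. ennreal ((f j x)\<^sup>2)) \<longlonglongrightarrow> ennreal ((g x)\<^sup>2)"
        by (intro tendsto_intros)
      then show ?case by (intro lim_imp_Liminf[symmetric]) auto
    qed
  qed
  also have "\<dots> \<le> liminf (\<lambda>j. \<integral>\<^sup>+x. ennreal ((f j x)\<^sup>2) \<partial>?M)"
    by (rule nn_integral_liminf) measurable
  also have "\<dots> \<le> ennreal B"
  proof (rule Liminf_le)
    show "\<forall>\<^sub>F j in sequentially. (\<integral>\<^sup>+x. ennreal ((f j x)\<^sup>2) \<partial>?M) \<le> ennreal B"
      unfolding nn using bound by (auto simp: eventually_sequentially intro!: exI[of _ N] ennreal_leI)
  qed simp
  finally have le: "(\<integral>\<^sup>+x. ennreal ((g x)\<^sup>2) \<partial>?M) \<le> ennreal B" .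
  have int: "integrable ?M (\<lambda>x. (g x)\<^sup>2)"
    using le by (intro integrableI_bounded) (auto simp: top_unique less_top[symmetric])
  then show "g \<in> L2_on S" using g by (simp add: L2_on_def)
  have "ennreal (sqint S g) \<le> ennreal B"
    using le nn_integral_eq_integral[OF int] by (simp add: sqint_def)
  then show "sqint S g \<le> B" using B by simp
qed

text \<open>
  The Riesz--Fischer argument: along a subsequence with square distances below \<open>8\<^sup>-\<^sup>i\<close> the
  series of \<open>4\<^sup>i\<close> times the squared increments has a finite integral, so almost everywhere the
  increments are eventually below \<open>2\<^sup>-\<^sup>i\<close>. The limit is only claimed to be measurable;
  membership in \<open>L\<^sup>2\<close> and convergence in norm come from Fatou's lemma where they are needed.
\<close>
lemma L2_on_Cauchy_AE_subseq:
  fixes u :: "nat \<Rightarrow> 'a::euclidean_space \<Rightarrow> real"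
  assumes u: "\<And>k. u k \<in> L2_on S"
    and Cauchy: "\<And>\<epsilon>. \<epsilon> > 0 \<Longrightarrow> \<exists>N. \<forall>j\<ge>N. \<forall>k\<ge>N. sqint S (\<lambda>x. u j x - u k x) < \<epsilon>"
  obtains r g where "strict_mono r" "g \<in> borel_measurable (lebesgue_on S)"
    "AE x in lebesgue_on S. (\<lambda>i. u (r i) x) \<longlonglongrightarrow> g x"
proof -
  let ?M = "lebesgue_on S"
  have [measurable]: "u k \<in> borel_measurable ?M" for k using u by (simp add: L2_on_def)
  have "\<forall>i. \<exists>N. \<forall>j\<ge>N. \<forall>k\<ge>N. sqint S (\<lambda>x. u j x - u k x) < (1 / 8) ^ i"
    using Cauchy by simp
  then obtain N where N: "\<And>i j k. j \<ge> N i \<Longrightarrow> k \<ge> N i \<Longrightarrow>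
      sqint S (\<lambda>x. u j x - u k x) < (1 / 8) ^ i"
    by metis
  \<comment> \<open>The partial sums dominate \<open>N\<close>, and the summand \<open>i\<close> makes the indices strictly increasing.\<close>
  define r where "r i = (\<Sum>j\<le>i. N j) + i" for i
  have r: "strict_mono r" by (auto simp: r_def strict_mono_Suc_iff)
  have rN: "N i \<le> r i" for i
    using member_le_sum[of i "{..i}" N] by (simp add: r_def)
  have rN': "N i \<le> r (Suc i)" for i
    using rN[of i] r by (meson lessI less_imp_le order_trans strict_monoD)
  define h where "h i x = 4 ^ i * (u (r (Suc i)) x - u (r i) x)\<^sup>2" for i x
  have [measurable]: "h i \<in> borel_measurable ?M" for i unfolding h_def by measurable
  have h0: "0 \<le> h i x" for i x by (simp add: h_def)
  have "(\<integral>\<^sup>+x. ennreal (h i x) \<partial>?M) \<le> ennreal ((1 / 2) ^ i)" for i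
  proof -
    have int: "integrable ?M (h i)"
      using L2_on_diff[OF u u, of "r (Suc i)" "r i"] by (simp add: h_def[abs_def] L2_on_def)
    have "(LINT x|?M. h i x) = 4 ^ i * sqint S (\<lambda>x. u (r (Suc i)) x - u (r i) x)"
      by (simp add: h_def sqint_def)
    also have "\<dots> \<le> 4 ^ i * (1 / 8) ^ i"
      using N[OF rN' rN, of i] by (intro mult_left_mono) auto
    also have "\<dots> = (1 / 2) ^ i" by (simp add: power_mult_distrib[symmetric])
    finally show ?thesis
      using nn_integral_eq_integral[OF int] h0 by (simp add: ennreal_leI)
  qed
  then have "(\<Sum>i. \<integral>\<^sup>+x. ennreal (h i x) \<partial>?M) \<le> (\<Sum>i. ennreal ((1 / 2) ^ i))"
    by (intro suminf_le) auto
  also have "(\<Sum>i. ennreal ((1 / 2) ^ i)) = ennreal (\<Sum>i. (1 / 2) ^ i)"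
    by (rule suminf_ennreal2) (simp_all add: summable_geometric)
  also have "\<dots> < \<infinity>" unfolding infinity_ennreal_def by (rule ennreal_less_top)
  finally have "(\<Sum>i. \<integral>\<^sup>+x. ennreal (h i x) \<partial>?M) < \<infinity>" .
  moreover have "(\<integral>\<^sup>+x. (\<Sum>i. ennreal (h i x)) \<partial>?M) = (\<Sum>i. \<integral>\<^sup>+x. ennreal (h i x) \<partial>?M)"
    by (rule nn_integral_suminf) measurable
  ultimately have "(\<integral>\<^sup>+x. (\<Sum>i. ennreal (h i x)) \<partial>?M) \<noteq> \<infinity>"
    by (metis less_irrefl)
  then have "AE x in ?M. (\<Sum>i. ennreal (h i x)) \<noteq> \<infinity>"
    by (rule nn_integral_PInf_AE[rotated]) measurable
  then have conv: "AE x in ?M. convergent (\<lambda>i. u (r i) x)"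
  proof eventually_elim
    case (elim x)
    let ?d = "\<lambda>i. u (r (Suc i)) x - u (r i) x"
    have "summable (\<lambda>i. h i x)"
      using elim h0 by (intro summable_suminf_not_top) auto
    then have "(\<lambda>i. h i x) \<longlonglongrightarrow> 0" by (rule summable_LIMSEQ_zero)
    then have "\<forall>\<^sub>F i in sequentially. h i x < 1" by (rule order_tendstoD) simp
    then have "\<forall>\<^sub>F i in sequentially. norm (?d i) \<le> (1 / 2) ^ i"
    proof eventually_elim
      case (elim i)
      have "(?d i)\<^sup>2 \<le> ((1 / 2) ^ i)\<^sup>2"
        using elim by (simp add: h_def field_simps power2_eq_square power_mult_distrib[symmetric])
      then show ?case
        using abs_le_square_iff[of "?d i" "(1 / 2) ^ i"] by simp
    qed
    then have "summable ?d"
      by (rule summable_comparison_test_ev) (simp add: summable_geometric)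
    then have "convergent (\<lambda>n. \<Sum>i<n. ?d i)" by (simp add: summable_iff_convergent)
    then have "convergent (\<lambda>n. u (r n) x - u (r 0) x)"
      by (simp add: sum_lessThan_telescope[of "\<lambda>i. u (r i) x"])
    then show ?case
      using convergent_add[OF _ convergent_const[of "u (r 0) x"]] by fastforce
  qed
  show ?thesis
  proof
    show "strict_mono r" by (rule r)
    show "(\<lambda>x. lim (\<lambda>i. u (r i) x)) \<in> borel_measurable ?M" by measurable
    show "AE x in ?M. (\<lambda>i. u (r i) x) \<longlonglongrightarrow> lim (\<lambda>i. u (r i) x)"
      using conv by eventually_elim (simp add: convergent_LIMSEQ_iff)
  qed
qed

section \<open>The energy space and its bilinear forms\<close>

text \<open>
  The square root of the kernel is put into the gradient, so that finite energy is
  plain square integrability of the gradient on pairs.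
\<close>
definition nonlocal_gradient :: "(real \<Rightarrow> real) \<Rightarrow> ('a::euclidean_space \<Rightarrow> real) \<Rightarrow> 'a \<times> 'a \<Rightarrow> real"
  where "nonlocal_gradient K u z =
    sqrt (K (norm (fst z - snd z))) * ((u (fst z) - u (snd z)) / norm (fst z - snd z))"

lemma nonlocal_gradient_lincomb:
  "nonlocal_gradient K (\<lambda>x. a * u x + b * v x) =
    (\<lambda>z. a * nonlocal_gradient K u z + b * nonlocal_gradient K v z)"
  by (auto simp: nonlocal_gradient_def fun_eq_iff diff_divide_distrib add_divide_distrib algebra_simps)

lemma nonlocal_gradient_diff:
  "nonlocal_gradient K (\<lambda>x. u x - v x) =
    (\<lambda>z. nonlocal_gradient K u z - nonlocal_gradient K v z)"
  using nonlocal_gradient_lincomb[of K 1 u "-1" v] by simp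

lemma form_integrand_eq_gradient:
  fixes u v :: "'a::euclidean_space \<Rightarrow> real"
  assumes "\<And>r. r \<ge> 0 \<Longrightarrow> K r \<ge> 0"
  shows "form_integrand K \<kappa> u v =
    (\<lambda>z. \<kappa> (fst z) (snd z) * (nonlocal_gradient K u z * nonlocal_gradient K v z))"
proof
  fix z :: "'a \<times> 'a"
  have "sqrt (K (norm (fst z - snd z))) * sqrt (K (norm (fst z - snd z))) = K (norm (fst z - snd z))"
    using assms by simp
  moreover have "c * k * x * y = c * ((s * x) * (s * y))" if "s * s = k" for c k s x y :: real
    using that by auto
  ultimately show "form_integrand K \<kappa> u v z =
      \<kappa> (fst z) (snd z) * (nonlocal_gradient K u z * nonlocal_gradient K v z)"
    unfolding form_integrand_def nonlocal_gradient_def case_prod_beta by blast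
qed

lemma nonlocal_form_commute: "nonlocal_form K \<delta> \<Omega> \<kappa> u v = nonlocal_form K \<delta> \<Omega> \<kappa> v u"
  by (simp add: nonlocal_form_def form_integrand_def mult.commute mult.left_commute)

text \<open>
  The last assumption is the form in which the singular lower bound of the kernel enters the
  Poincare inequality: a uniform bound on an annulus, whose shifts are long enough to leave the
  domain after a fixed number of steps and short enough not to leave its enlargement.
\<close>
locale nonlocal_domain =
  fixes K :: "real \<Rightarrow> real" and \<delta> :: real and \<Omega> :: "'a::euclidean_space set"
  assumes open_domain: "open \<Omega>" and bounded_domain: "bounded \<Omega>" and \<delta>_pos: "\<delta> > 0"
    and kernel_nonneg: "\<And>r. r \<ge> 0 \<Longrightarrow> K r \<ge> 0"
    and kernel_integrable: "integrable lebesgue (\<lambda>x::'a. K (norm x))"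
    and kernel_bounded_below: "\<exists>c>0. \<forall>h::'a. \<delta> / 4 \<le> norm h \<longrightarrow> norm h < \<delta> / 2 \<longrightarrow>
      c \<le> K (norm h) / (norm h)\<^sup>2"
begin

abbreviation S :: "'a set" where "S \<equiv> enlarge \<delta> \<Omega>"
abbreviation G :: "('a \<Rightarrow> real) \<Rightarrow> 'a \<times> 'a \<Rightarrow> real" where "G \<equiv> nonlocal_gradient K"
abbreviation U :: "('a \<Rightarrow> real) set" where "U \<equiv> energy_space K \<delta> \<Omega>"
abbreviation U0 :: "('a \<Rightarrow> real) set" where "U0 \<equiv> energy_space_0 K \<delta> \<Omega>"
abbreviation form :: "('a \<Rightarrow> 'a \<Rightarrow> real) \<Rightarrow> ('a \<Rightarrow> real) \<Rightarrow> ('a \<Rightarrow> real) \<Rightarrow> real"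
  where "form \<equiv> nonlocal_form K \<delta> \<Omega>"
definition energy :: "('a \<Rightarrow> real) \<Rightarrow> real"
  where "energy u = sqint S u + sqint (S \<times> S) (G u)"

lemma open_S: "open S" by (auto simp: enlarge_def)

lemma bounded_S: "bounded S"
proof -
  obtain R where R: "\<And>x. x \<in> \<Omega> \<Longrightarrow> norm x \<le> R"
    using bounded_domain by (auto simp: bounded_iff)
  have "norm y \<le> R + \<delta>" if y: "y \<in> S" for y
  proof -
    obtain x where x: "x \<in> \<Omega>" "dist x y < \<delta>" using y by (auto simp: enlarge_def)
    have "norm y \<le> norm x + dist x y"
      by (metis add.commute diff_add_cancel dist_commute dist_norm norm_triangle_ineq)
    then show ?thesis using R[OF x(1)] x(2) by linarith
  qed
  then show ?thesis by (auto simp: bounded_iff)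
qed

lemma domain_subset_S: "\<Omega> \<subseteq> S"
  using \<delta>_pos by (force simp: enlarge_def)

lemma near_domain_in_S: "x \<in> \<Omega> \<Longrightarrow> norm (y - x) < \<delta> \<Longrightarrow> y \<in> S"
  by (auto simp: enlarge_def dist_norm norm_minus_commute)

lemma sets_lebesgue_S: "\<Omega> \<in> sets lebesgue" "S \<in> sets lebesgue" "S \<times> S \<in> sets lebesgue"
  using open_domain open_S by (auto intro!: sets_completionI_sets simp: open_Times)

lemma finite_measure_S: "finite_measure (lebesgue_on S)" "finite_measure (lebesgue_on \<Omega>)"
  using open_S bounded_S open_domain bounded_domain
  by (auto intro!: finite_measure_lebesgue_on lmeasurable_open)

lemmas measurable_fst_S [measurable] = measurable_fst_lebesgue_on[OF open_S]
lemmas measurable_snd_S [measurable] = measurable_snd_lebesgue_on[OF open_S]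

lemma kernel_measurable [measurable]:
  "(\<lambda>z. K (norm (fst z - snd z))) \<in> borel_measurable (lebesgue_on (S \<times> S))"
proof -
  have "(\<lambda>x::'a. K (norm x)) \<in> borel_measurable lebesgue"
    using kernel_integrable by auto
  from measurable_compose[OF measurable_diff_lebesgue this] show ?thesis
    by (rule measurable_restrict_space1)
qed

lemma gradient_measurable [measurable]:
  assumes [measurable]: "u \<in> borel_measurable (lebesgue_on S)"
  shows "G u \<in> borel_measurable (lebesgue_on (S \<times> S))"
proof -
  have "(\<lambda>z::'a \<times> 'a. norm (fst z - snd z)) \<in> borel_measurable borel"
    by (intro borel_measurable_continuous_onI continuous_intros)
  then have [measurable]: "(\<lambda>z::'a \<times> 'a. norm (fst z - snd z)) \<in> borel_measurable (lebesgue_on (S \<times> S))"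
    by (intro measurable_restrict_space1 measurable_completion) simp
  show ?thesis unfolding nonlocal_gradient_def[abs_def] by measurable
qed

lemma form_integrand_eq:
  "form_integrand K \<kappa> u v = (\<lambda>z. \<kappa> (fst z) (snd z) * (G u z * G v z))"
  by (rule form_integrand_eq_gradient) (rule kernel_nonneg)

lemma energy_space_iff: "u \<in> U \<longleftrightarrow> u \<in> L2_on S \<and> G u \<in> L2_on (S \<times> S)"
  using gradient_measurable[of u]
  by (auto simp: energy_space_def L2_on_def form_integrand_eq power2_eq_square)

lemma energy_spaceD:
  assumes "u \<in> U"
  shows "u \<in> L2_on S" "G u \<in> L2_on (S \<times> S)"
  using assms by (simp_all add: energy_space_iff)

lemma energy_norm_eq: "energy_norm K \<delta> \<Omega> u = sqrt (energy u)"
  using sqint_nonneg[of S u]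
  by (simp add: energy_norm_def L2_norm_on_def nonlocal_form_def energy_def sqint_def
      form_integrand_eq power2_eq_square)

lemma energy_space_lincomb: "u \<in> U \<Longrightarrow> v \<in> U \<Longrightarrow> (\<lambda>x. a * u x + b * v x) \<in> U"
  by (simp add: energy_space_iff L2_on_lincomb nonlocal_gradient_lincomb)

lemma energy_lincomb_le:
  assumes "u \<in> U" "v \<in> U"
  shows "energy (\<lambda>x. a * u x + b * v x) \<le> 2 * a\<^sup>2 * energy u + 2 * b\<^sup>2 * energy v"
  using sqint_lincomb_le[of u S v a b] sqint_lincomb_le[of "G u" "S \<times> S" "G v" a b] assms
  by (simp add: energy_def energy_space_iff nonlocal_gradient_lincomb algebra_simps)

text \<open>
  The bounds hold only almost everywhere on pairs, since designs are bounded only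
  almost everywhere.
\<close>
definition elliptic :: "real \<Rightarrow> real \<Rightarrow> ('a \<Rightarrow> 'a \<Rightarrow> real) \<Rightarrow> bool" where
  "elliptic lo hi \<kappa> \<longleftrightarrow> 0 < lo \<and> lo \<le> hi \<and>
    (\<lambda>z. \<kappa> (fst z) (snd z)) \<in> borel_measurable (lebesgue_on (S \<times> S)) \<and>
    (AE z in lebesgue_on (S \<times> S). lo \<le> \<kappa> (fst z) (snd z) \<and> \<kappa> (fst z) (snd z) \<le> hi)"

lemma form_integrable:
  assumes \<kappa>: "elliptic lo hi \<kappa>" and u: "u \<in> U" and v: "v \<in> U"
  shows "integrable (lebesgue_on (S \<times> S)) (form_integrand K \<kappa> u v)"
proof (rule Bochner_Integration.integrable_bound)
  show "integrable (lebesgue_on (S \<times> S)) (\<lambda>z. hi * (G u z * G v z))"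
    using L2_on_integrable_mult u v by (auto simp: energy_space_iff)
  have [measurable]: "G u \<in> borel_measurable (lebesgue_on (S \<times> S))"
      "G v \<in> borel_measurable (lebesgue_on (S \<times> S))"
    using u v by (auto simp: energy_space_iff L2_on_def)
  have [measurable]: "(\<lambda>z. \<kappa> (fst z) (snd z)) \<in> borel_measurable (lebesgue_on (S \<times> S))"
    using \<kappa> by (simp add: elliptic_def)
  show "form_integrand K \<kappa> u v \<in> borel_measurable (lebesgue_on (S \<times> S))"
    unfolding form_integrand_eq by measurable
  have lo: "0 < lo" using \<kappa> by (simp add: elliptic_def)
  have "AE z in lebesgue_on (S \<times> S). lo \<le> \<kappa> (fst z) (snd z) \<and> \<kappa> (fst z) (snd z) \<le> hi"
    using \<kappa> by (simp add: elliptic_def)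
  then show "AE z in lebesgue_on (S \<times> S).
      norm (form_integrand K \<kappa> u v z) \<le> norm (hi * (G u z * G v z))"
  proof eventually_elim
    case (elim z)
    then have "\<bar>\<kappa> (fst z) (snd z)\<bar> \<le> \<bar>hi\<bar>" using lo by auto
    then show ?case by (simp add: form_integrand_eq abs_mult mult_right_mono)
  qed
qed

lemma form_lincomb_left:
  assumes "elliptic lo hi \<kappa>" "u \<in> U" "v \<in> U" "w \<in> U"
  shows "form \<kappa> (\<lambda>x. a * u x + b * v x) w = a * form \<kappa> u w + b * form \<kappa> v w"
proof -
  have "form_integrand K \<kappa> (\<lambda>x. a * u x + b * v x) w =
      (\<lambda>z. a * form_integrand K \<kappa> u w z + b * form_integrand K \<kappa> v w z)"
    by (simp add: form_integrand_eq nonlocal_gradient_lincomb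
        algebra_simps fun_eq_iff)
  then show ?thesis
    using form_integrable[OF assms(1)] assms by (simp add: nonlocal_form_def)
qed

lemma form_lincomb_square:
  assumes \<kappa>: "elliptic lo hi \<kappa>" and u: "u \<in> U" and v: "v \<in> U"
  shows "form \<kappa> (\<lambda>x. a * u x + b * v x) (\<lambda>x. a * u x + b * v x) =
    a\<^sup>2 * form \<kappa> u u + 2 * a * b * form \<kappa> u v + b\<^sup>2 * form \<kappa> v v"
proof -
  have w: "(\<lambda>x. a * u x + b * v x) \<in> U" by (rule energy_space_lincomb[OF u v])
  let ?w = "\<lambda>x. a * u x + b * v x"
  have "form \<kappa> ?w ?w = a * form \<kappa> u ?w + b * form \<kappa> v ?w"
    by (rule form_lincomb_left[OF \<kappa> u v w])
  also have "form \<kappa> u ?w = a * form \<kappa> u u + b * form \<kappa> v u"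
    using form_lincomb_left[OF \<kappa> u v u] nonlocal_form_commute by metis
  also have "form \<kappa> v ?w = a * form \<kappa> u v + b * form \<kappa> v v"
    using form_lincomb_left[OF \<kappa> u v v] nonlocal_form_commute by metis
  also have "form \<kappa> v u = form \<kappa> u v" by (rule nonlocal_form_commute)
  finally show ?thesis by (simp add: power2_eq_square algebra_simps)
qed

lemma
  assumes \<kappa>: "elliptic lo hi \<kappa>" and u: "u \<in> U"
  shows form_lower: "lo * sqint (S \<times> S) (G u) \<le> form \<kappa> u u"
    and form_upper: "form \<kappa> u u \<le> hi * sqint (S \<times> S) (G u)"
proof -
  have int: "integrable (lebesgue_on (S \<times> S)) (\<lambda>z. (G u z)\<^sup>2)"
    using u by (simp add: energy_space_iff L2_on_def)
  have intf: "integrable (lebesgue_on (S \<times> S)) (form_integrand K \<kappa> u u)"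
    by (rule form_integrable[OF \<kappa> u u])
  have AE: "AE z in lebesgue_on (S \<times> S). lo \<le> \<kappa> (fst z) (snd z) \<and> \<kappa> (fst z) (snd z) \<le> hi"
    using \<kappa> by (simp add: elliptic_def)
  have "(LINT z|lebesgue_on (S \<times> S). lo * (G u z)\<^sup>2) \<le> form \<kappa> u u"
    unfolding nonlocal_form_def
  proof (rule integral_mono_AE)
    show "AE z in lebesgue_on (S \<times> S). lo * (G u z)\<^sup>2 \<le> form_integrand K \<kappa> u u z"
      using AE by eventually_elim
        (auto simp: form_integrand_eq power2_eq_square intro!: mult_right_mono)
  qed (use int intf in auto)
  then show "lo * sqint (S \<times> S) (G u) \<le> form \<kappa> u u" by (simp add: sqint_def)
  have "form \<kappa> u u \<le> (LINT z|lebesgue_on (S \<times> S). hi * (G u z)\<^sup>2)"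
    unfolding nonlocal_form_def
  proof (rule integral_mono_AE)
    show "AE z in lebesgue_on (S \<times> S). form_integrand K \<kappa> u u z \<le> hi * (G u z)\<^sup>2"
      using AE by eventually_elim
        (auto simp: form_integrand_eq power2_eq_square intro!: mult_right_mono)
  qed (use int intf in auto)
  then show "form \<kappa> u u \<le> hi * sqint (S \<times> S) (G u)" by (simp add: sqint_def)
qed

lemma form_nonneg:
  assumes "elliptic lo hi \<kappa>" "u \<in> U"
  shows "0 \<le> form \<kappa> u u"
proof -
  have "0 \<le> lo * sqint (S \<times> S) (G u)"
    using assms(1) by (intro mult_nonneg_nonneg sqint_nonneg) (simp add: elliptic_def)
  then show ?thesis using form_lower[OF assms] by linarith
qed

text \<open>The discriminant of the nonnegative quadratic \<open>t \<mapsto> a(t u + v, t u + v)\<close>.\<close>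
lemma form_Cauchy_Schwarz:
  assumes \<kappa>: "elliptic lo hi \<kappa>" and u: "u \<in> U" and v: "v \<in> U"
  shows "(form \<kappa> u v)\<^sup>2 \<le> form \<kappa> u u * form \<kappa> v v"
proof (rule nonneg_quadratic_discriminant)
  fix t
  have "0 \<le> form \<kappa> (\<lambda>x. t * u x + 1 * v x) (\<lambda>x. t * u x + 1 * v x)"
    by (rule form_nonneg[OF \<kappa> energy_space_lincomb[OF u v]])
  then show "0 \<le> form \<kappa> u u * t\<^sup>2 + 2 * form \<kappa> u v * t + form \<kappa> v v"
    unfolding form_lincomb_square[OF \<kappa> u v] by (simp add: algebra_simps)
qed (rule form_nonneg[OF \<kappa> u])

text \<open>
  Almost everywhere convergence of \<open>u\<close> on \<open>S\<close> carries over to the gradients on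
  \<open>S \<times> S\<close>, because preimages of null sets under both projections are null. Hence one subsequence and
  Fatou's lemma settle both parts of the energy at once.
\<close>
lemma energy_space_complete:
  fixes u :: "nat \<Rightarrow> 'a \<Rightarrow> real"
  assumes u: "\<And>k. u k \<in> U"
    and Cauchy: "\<And>\<epsilon>. \<epsilon> > 0 \<Longrightarrow> \<exists>N. \<forall>j\<ge>N. \<forall>k\<ge>N. energy (\<lambda>x. u j x - u k x) < \<epsilon>"
  obtains w where "w \<in> U"
    and "\<And>\<epsilon>. \<epsilon> > 0 \<Longrightarrow> \<exists>N. \<forall>k\<ge>N. energy (\<lambda>x. u k x - w x) \<le> \<epsilon>"
proof -
  have uL: "\<And>k. u k \<in> L2_on S" "\<And>k. G (u k) \<in> L2_on (S \<times> S)"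
    using u by (simp_all add: energy_space_iff)
  have "\<exists>N. \<forall>j\<ge>N. \<forall>k\<ge>N. sqint S (\<lambda>x. u j x - u k x) < \<epsilon>" if \<epsilon>: "\<epsilon> > 0" for \<epsilon>
  proof -
    obtain N where N: "\<And>j k. j \<ge> N \<Longrightarrow> k \<ge> N \<Longrightarrow> energy (\<lambda>x. u j x - u k x) < \<epsilon>"
      using Cauchy[OF \<epsilon>] by blast
    have "sqint S (\<lambda>x. u j x - u k x) < \<epsilon>" if "j \<ge> N" "k \<ge> N" for j k
      using N[OF that] sqint_nonneg[of "S \<times> S" "G (\<lambda>x. u j x - u k x)"] unfolding energy_def by linarith
    then show ?thesis by blast
  qed
  from L2_on_Cauchy_AE_subseq[OF uL(1) this]
  obtain r w where r: "strict_mono r" and w: "w \<in> borel_measurable (lebesgue_on S)"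
    and lim: "AE x in lebesgue_on S. (\<lambda>i. u (r i) x) \<longlonglongrightarrow> w x" by blast
  have limG: "AE z in lebesgue_on (S \<times> S). (\<lambda>i. G (u (r i)) z) \<longlonglongrightarrow> G w z"
    using AE_fst_lebesgue_on[OF open_S lim] AE_snd_lebesgue_on[OF open_S lim]
  proof eventually_elim
    case (elim z)
    then have "(\<lambda>i. u (r i) (fst z) - u (r i) (snd z)) \<longlonglongrightarrow> w (fst z) - w (snd z)"
      by (intro tendsto_diff)
    then show ?case unfolding nonlocal_gradient_def divide_inverse
      by (intro tendsto_mult tendsto_const)
  qed
  \<comment> \<open>Fatou's lemma passes to the limit in the second index of the Cauchy condition.\<close>
  have limit: "(\<lambda>x. u k x - w x) \<in> U" "energy (\<lambda>x. u k x - w x) \<le> 2 * \<epsilon>"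
    if N: "\<And>j k. j \<ge> N \<Longrightarrow> k \<ge> N \<Longrightarrow> energy (\<lambda>x. u j x - u k x) < \<epsilon>" and k: "k \<ge> N"
    for k N \<epsilon>
  proof -
    have N1: "sqint S (\<lambda>x. u k x - u (r j) x) \<le> \<epsilon>"
      and N2: "sqint (S \<times> S) (\<lambda>z. G (u k) z - G (u (r j)) z) \<le> \<epsilon>" if "j \<ge> N" for j
    proof -
      have "r j \<ge> N" using seq_suble[OF r, of j] that by simp
      from N[OF k this] show "sqint S (\<lambda>x. u k x - u (r j) x) \<le> \<epsilon>"
          "sqint (S \<times> S) (\<lambda>z. G (u k) z - G (u (r j)) z) \<le> \<epsilon>"
        using sqint_nonneg[of S "\<lambda>x. u k x - u (r j) x"]
          sqint_nonneg[of "S \<times> S" "\<lambda>z. G (u k) z - G (u (r j)) z"]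
        unfolding nonlocal_gradient_diff energy_def by linarith+
    qed
    have [measurable]: "u k \<in> borel_measurable (lebesgue_on S)"
      using uL by (simp add: L2_on_def)
    have m: "(\<lambda>x. u k x - w x) \<in> borel_measurable (lebesgue_on S)" using w by measurable
    have "AE x in lebesgue_on S. (\<lambda>i. u k x - u (r i) x) \<longlonglongrightarrow> u k x - w x"
      using lim by eventually_elim (intro tendsto_intros)
    note F1 = L2_on_Fatou[where B = \<epsilon> and N = N, OF L2_on_diff[OF uL(1) uL(1)] _ m this]
    have "AE z in lebesgue_on (S \<times> S). (\<lambda>i. G (u k) z - G (u (r i)) z) \<longlonglongrightarrow> G (\<lambda>x. u k x - w x) z"
      using limG unfolding nonlocal_gradient_diff by eventually_elim (intro tendsto_intros)
    note F2 = L2_on_Fatou[where B = \<epsilon> and N = N, OF L2_on_diff[OF uL(2) uL(2)] _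
        gradient_measurable[OF m] this]
    show "(\<lambda>x. u k x - w x) \<in> U"
      unfolding energy_space_iff using F1(1) F2(1) N1 N2 by blast
    have "sqint S (\<lambda>x. u k x - w x) \<le> \<epsilon>" "sqint (S \<times> S) (G (\<lambda>x. u k x - w x)) \<le> \<epsilon>"
      using F1(2) F2(2) N1 N2 by blast+
    then show "energy (\<lambda>x. u k x - w x) \<le> 2 * \<epsilon>" by (simp add: energy_def)
  qed
  show ?thesis
  proof
    obtain N where "\<And>j k. j \<ge> N \<Longrightarrow> k \<ge> N \<Longrightarrow> energy (\<lambda>x. u j x - u k x) < 1"
      using Cauchy[of 1] by auto
    from limit(1)[OF this order_refl] have "(\<lambda>x. u N x - w x) \<in> U" by blast
    from energy_space_lincomb[OF u[of N] this, of 1 "-1"]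
    show "w \<in> U" by simp
    show "\<exists>N. \<forall>k\<ge>N. energy (\<lambda>x. u k x - w x) \<le> \<epsilon>" if "\<epsilon> > 0" for \<epsilon>
    proof -
      obtain N where N: "\<And>j k. j \<ge> N \<Longrightarrow> k \<ge> N \<Longrightarrow> energy (\<lambda>x. u j x - u k x) < \<epsilon> / 2"
        using Cauchy[of "\<epsilon> / 2"] \<open>\<epsilon> > 0\<close> by auto
      show ?thesis using limit(2)[OF N] by force
    qed
  qed
qed

end

section \<open>Test functions have finite energy\<close>

lemma Ck_lincomb: "Ck k f \<Longrightarrow> Ck k g \<Longrightarrow> Ck k (\<lambda>x. a * f x + b * g x)"
proof (induction k arbitrary: f g)
  case 0
  then show ?case by (auto intro!: continuous_intros)
next
  case (Suc k)
  have fg: "(f has_derivative frechet_derivative f (at x)) (at x)"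
      "(g has_derivative frechet_derivative g (at x)) (at x)" for x
    using Suc.prems by (auto simp: differentiable_on_def frechet_derivative_works)
  then have d: "((\<lambda>x. a * f x + b * g x) has_derivative
      (\<lambda>h. a * frechet_derivative f (at x) h + b * frechet_derivative g (at x) h)) (at x)" for x
    by (intro derivative_intros)
  have "frechet_derivative (\<lambda>x. a * f x + b * g x) (at x) =
      (\<lambda>h. a * frechet_derivative f (at x) h + b * frechet_derivative g (at x) h)" for x
    by (rule frechet_derivative_at[OF d, symmetric])
  moreover have "(\<lambda>x. a * f x + b * g x) differentiable_on UNIV"
    unfolding differentiable_on_def differentiable_def using d by blast
  ultimately show ?case using Suc by simp
qed

lemma test_functions_lincomb:
  assumes "\<phi> \<in> test_functions \<Omega>" "\<psi> \<in> test_functions \<Omega>"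
  shows "(\<lambda>x. a * \<phi> x + b * \<psi> x) \<in> test_functions \<Omega>"
proof -
  let ?T = "closure {x. \<phi> x \<noteq> 0} \<union> closure {x. \<psi> x \<noteq> 0}"
  have "{x. a * \<phi> x + b * \<psi> x \<noteq> 0} \<subseteq> {x. \<phi> x \<noteq> 0} \<union> {x. \<psi> x \<noteq> 0}" by auto
  also have "\<dots> \<subseteq> ?T" by (intro Un_mono closure_subset)
  finally have sub: "closure {x. a * \<phi> x + b * \<psi> x \<noteq> 0} \<subseteq> ?T"
    by (intro closure_minimal) auto
  have T: "compact ?T" "?T \<subseteq> \<Omega>"
    using assms by (auto simp: test_functions_def)
  have "compact (closure {x. a * \<phi> x + b * \<psi> x \<noteq> 0})"
    using compact_Int_closed[OF T(1) closed_closure[of "{x. a * \<phi> x + b * \<psi> x \<noteq> 0}"]] sub by (simp only: inf.absorb2)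
  then show ?thesis
    using assms T(2) sub Ck_lincomb unfolding test_functions_def by blast
qed

lemma Ck_zero: "Ck k (\<lambda>_. 0)"
proof (induction k)
  case (Suc k)
  have "frechet_derivative (\<lambda>_. 0) (at x) = (\<lambda>_. 0 :: real)" for x :: 'a
    by (rule frechet_derivative_at[OF has_derivative_const, symmetric])
  then show ?case using Suc by simp
qed simp

lemma zero_test_function: "(\<lambda>_. 0) \<in> test_functions \<Omega>"
  by (simp add: test_functions_def Ck_zero)

lemma test_function_zero_outside: "\<phi> \<in> test_functions \<Omega> \<Longrightarrow> x \<notin> \<Omega> \<Longrightarrow> \<phi> x = 0"
  using closure_subset[of "{x. \<phi> x \<noteq> 0}"] by (auto simp: test_functions_def)

lemma test_function_continuous: "\<phi> \<in> test_functions \<Omega> \<Longrightarrow> continuous_on UNIV \<phi>"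
  by (auto simp: test_functions_def dest: spec[of _ 0])

lemma test_function_bounded:
  assumes \<phi>: "\<phi> \<in> test_functions \<Omega>"
  obtains B where "\<And>x. \<bar>\<phi> x\<bar> \<le> B"
proof -
  let ?T = "closure {x. \<phi> x \<noteq> 0}"
  have "compact (\<phi> ` ?T)"
    using \<phi> test_function_continuous[OF \<phi>]
    by (intro compact_continuous_image) (auto simp: test_functions_def intro: continuous_on_subset)
  then obtain B where B: "\<And>x. x \<in> ?T \<Longrightarrow> \<bar>\<phi> x\<bar> \<le> B"
    using compact_imp_bounded by (fastforce simp: bounded_iff)
  have "\<bar>\<phi> x\<bar> \<le> max 0 B" for x
  proof (cases "\<phi> x = 0")
    case False
    then have "x \<in> ?T" using closure_subset[of "{x. \<phi> x \<noteq> 0}"] by auto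
    then show ?thesis using B[of x] by simp
  qed simp
  then show ?thesis by (rule that)
qed

text \<open>
  The partial derivatives are continuous and vanish outside the compact support, so they are
  bounded, and the operator norm of the derivative is at most the sum of their absolute values.
\<close>
lemma test_function_Lipschitz:
  fixes \<phi> :: "'a::euclidean_space \<Rightarrow> real"
  assumes \<phi>: "\<phi> \<in> test_functions \<Omega>"
  obtains L where "\<And>x y. \<bar>\<phi> x - \<phi> y\<bar> \<le> L * norm (x - y)"
proof -
  let ?T = "closure {x. \<phi> x \<noteq> 0}"
  let ?D = "\<lambda>x. frechet_derivative \<phi> (at x)"
  have T: "compact ?T" using \<phi> by (simp add: test_functions_def)
  have C1: "Ck (Suc 0) \<phi>" using \<phi> unfolding test_functions_def by blast
  have D: "(\<phi> has_derivative ?D x) (at x)" for x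
    using C1 by (auto simp: differentiable_on_def frechet_derivative_works)
  have "\<exists>B. \<forall>x\<in>?T. \<bar>?D x i\<bar> \<le> B" if "i \<in> Basis" for i
  proof -
    have "compact ((\<lambda>x. ?D x i) ` ?T)"
      using C1 that T
      by (intro compact_continuous_image) (auto intro: continuous_on_subset)
    then show ?thesis using compact_imp_bounded by (fastforce simp: bounded_iff)
  qed
  then obtain B where B: "\<And>i x. i \<in> Basis \<Longrightarrow> x \<in> ?T \<Longrightarrow> \<bar>?D x i\<bar> \<le> B i"
    by metis
  have "?D x = (\<lambda>h. 0)" if "x \<notin> ?T" for x
  proof -
    have "open (- ?T)" "x \<in> - ?T" using that by auto
    then have "(\<phi> has_derivative (\<lambda>h. 0)) (at x)"
      using closure_subset[of "{x. \<phi> x \<noteq> 0}"]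
      by (intro has_derivative_transform_within_open[OF has_derivative_const[of 0], of "- ?T"]) auto
    then show ?thesis by (metis frechet_derivative_at)
  qed
  then have B': "\<bar>?D x i\<bar> \<le> max 0 (B i)" if "i \<in> Basis" for i x
    using B[OF that, of x] by (cases "x \<in> ?T") auto
  have "onorm (?D x) \<le> (\<Sum>i\<in>Basis. max 0 (B i))" for x
  proof (rule onorm_componentwise_le)
    show "bounded_linear (?D x)" using D by (rule has_derivative_bounded_linear)
    show "(\<Sum>i\<in>Basis. norm (?D x i)) \<le> (\<Sum>i\<in>Basis. max 0 (B i))"
      using B' by (intro sum_mono) auto
  qed
  then have "norm (\<phi> x - \<phi> y) \<le> (\<Sum>i\<in>Basis. max 0 (B i)) * norm (x - y)" for x y
    using D by (intro differentiable_bound[of UNIV]) auto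
  then show ?thesis by (intro that) auto
qed

context nonlocal_domain
begin

text \<open>
  By Tonelli and translation invariance the integral over pairs is at most the integral of
  the kernel times the volume of \<open>S\<close>. The kernel is replaced by a Borel version
  first, because Tonelli's theorem concerns the product of Borel measures.
\<close>
lemma kernel_integrable_pairs:
  "integrable (lebesgue_on (S \<times> S)) (\<lambda>z. K (norm (fst z - snd z)))"
proof (rule integrableI_bounded)
  have "(\<lambda>x::'a. K (norm x)) \<in> borel_measurable lebesgue" using kernel_integrable by auto
  then obtain k where k: "k \<in> borel_measurable lborel" "AE x in lborel. K (norm (x::'a)) = k x"
    using completion_ex_borel_measurable_real by blast
  have dm [measurable]: "(\<lambda>z::'a \<times> 'a. fst z - snd z) \<in> borel_measurable borel"
    by (intro borel_measurable_continuous_onI continuous_intros)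
  have "AE x in lebesgue. K (norm (x::'a)) = k x"
    using k(2) by (simp add: AE_completion_iff)
  from null_preserving_lebesgue(2)[OF dm null_sets_vimage_diff this]
  have "AE z in (lebesgue :: ('a \<times> 'a) measure). K (norm (fst z - snd z)) = k (fst z - snd z)"
    by blast
  then have AE: "AE z in (lborel :: ('a \<times> 'a) measure). K (norm (fst z - snd z)) = k (fst z - snd z)"
    by (simp add: AE_completion_iff)
  have [measurable]: "k \<in> borel_measurable borel" using k(1) by simp
  have [measurable]: "S \<in> sets borel" using open_S by simp
  have SS[measurable]: "S \<times> S \<in> sets (borel :: ('a \<times> 'a) measure)" using open_S by (simp add: open_Times)
  have "(\<integral>\<^sup>+z. ennreal (norm (K (norm (fst z - snd z)))) \<partial>lebesgue_on (S \<times> S)) =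
      (\<integral>\<^sup>+z. ennreal (norm (K (norm (fst z - snd z)))) * indicator (S \<times> S) z \<partial>lborel)"
    using sets_lebesgue_S by (simp add: nn_integral_restrict_space nn_integral_completion)
  also have "\<dots> = (\<integral>\<^sup>+z. ennreal (norm (k (fst z - snd z))) * indicator (S \<times> S) z \<partial>lborel)"
    using AE by (intro nn_integral_cong_AE) (auto elim!: eventually_mono)
  also have "\<dots> \<le> (\<integral>\<^sup>+z. ennreal (norm (k (fst z - snd z))) * indicator S (snd z) \<partial>lborel)"
    by (intro nn_integral_mono) (auto simp: indicator_def)
  also have "\<dots> = (\<integral>\<^sup>+y. \<integral>\<^sup>+x. ennreal (norm (k (x - y))) * indicator S y \<partial>lborel \<partial>lborel)"
    unfolding lborel_prod[symmetric] by (subst lborel_pair.nn_integral_snd[symmetric]) auto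
  also have "\<dots> = (\<integral>\<^sup>+y. (\<integral>\<^sup>+x. ennreal (norm (k x)) \<partial>lborel) * indicator S y \<partial>(lborel :: 'a measure))"
  proof (rule nn_integral_cong)
    fix y :: 'a
    have "(\<integral>\<^sup>+x. ennreal (norm (k (x - y))) * indicator S y \<partial>lborel) =
        (\<integral>\<^sup>+x. ennreal (norm (k (x - y))) \<partial>lborel) * indicator S y"
      by (rule nn_integral_multc) measurable
    also have "(\<integral>\<^sup>+x. ennreal (norm (k (x - y))) \<partial>lborel) = (\<integral>\<^sup>+x. ennreal (norm (k x)) \<partial>lborel)"
      using nn_integral_lborel_translate[of "\<lambda>x. ennreal (norm (k x))" "- y"] by simp
    finally show "(\<integral>\<^sup>+x. ennreal (norm (k (x - y))) * indicator S y \<partial>lborel) =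
        (\<integral>\<^sup>+x. ennreal (norm (k x)) \<partial>lborel) * indicator S y" .
  qed
  also have "\<dots> = (\<integral>\<^sup>+x. ennreal (norm (k x)) \<partial>lborel) * emeasure lborel S"
    by (simp add: nn_integral_cmult)
  also have "\<dots> < \<infinity>"
  proof -
    have "(\<integral>\<^sup>+x. ennreal (norm (k x)) \<partial>lborel) = (\<integral>\<^sup>+x. ennreal (norm (K (norm (x::'a)))) \<partial>lborel)"
      using k(2) by (intro nn_integral_cong_AE) (auto elim!: eventually_mono)
    also have "\<dots> < \<infinity>"
      using kernel_integrable by (simp add: integrable_iff_bounded nn_integral_completion)
    finally show ?thesis
      using emeasure_bounded_finite[OF bounded_S] by (simp add: ennreal_mult_less_top)
  qed
  finally show "(\<integral>\<^sup>+z. ennreal (norm (K (norm (fst z - snd z)))) \<partial>lebesgue_on (S \<times> S)) < \<infinity>" .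
qed measurable

lemma test_function_measurable:
  assumes \<phi>: "\<phi> \<in> test_functions \<Omega>"
  shows "\<phi> \<in> borel_measurable borel" "\<phi> \<in> borel_measurable (lebesgue_on S)"
proof -
  show b: "\<phi> \<in> borel_measurable borel"
    using test_function_continuous[OF \<phi>] by (rule borel_measurable_continuous_onI)
  then show "\<phi> \<in> borel_measurable (lebesgue_on S)"
    by (intro measurable_restrict_space1 measurable_completion) simp
qed

text \<open>
  A Lipschitz function has difference quotients bounded by some \<open>L\<close>, so the squared gradient is
  at most \<open>L\<^sup>2\<close> times the integrable kernel.
\<close>
lemma test_functions_energy_space:
  assumes \<phi>: "\<phi> \<in> test_functions \<Omega>"
  shows "\<phi> \<in> U"
  unfolding energy_space_iff
proof
  note [measurable] = test_function_measurable(2)[OF \<phi>]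
  obtain B where B: "\<And>x. \<bar>\<phi> x\<bar> \<le> B" using test_function_bounded[OF \<phi>] by blast
  have "integrable (lebesgue_on S) (\<lambda>x. (\<phi> x)\<^sup>2)"
  proof (rule finite_measure.integrable_const_bound[OF finite_measure_S(1)])
    show "AE x in lebesgue_on S. norm ((\<phi> x)\<^sup>2) \<le> B\<^sup>2"
      using B by (intro AE_I2) (simp add: abs_le_square_iff[symmetric] order_trans[OF _ abs_ge_self])
  qed measurable
  then show "\<phi> \<in> L2_on S" by (simp add: L2_on_def)
  obtain L where L: "\<And>x y. \<bar>\<phi> x - \<phi> y\<bar> \<le> L * norm (x - y)"
    using test_function_Lipschitz[OF \<phi>] by blast
  have "(G \<phi> z)\<^sup>2 \<le> L\<^sup>2 * K (norm (fst z - snd z))" for z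
  proof -
    let ?r = "norm (fst z - snd z)"
    have "\<bar>(\<phi> (fst z) - \<phi> (snd z)) / ?r\<bar> \<le> \<bar>L\<bar>"
    proof (cases "?r = 0")
      case False
      then have "\<bar>\<phi> (fst z) - \<phi> (snd z)\<bar> / ?r \<le> L"
        using L[of "fst z" "snd z"] by (simp add: divide_le_eq)
      then show ?thesis by (simp add: abs_divide)
    qed simp
    then have "((\<phi> (fst z) - \<phi> (snd z)) / ?r)\<^sup>2 \<le> L\<^sup>2"
      unfolding abs_le_square_iff .
    from mult_left_mono[OF this, of "K ?r"]
    have "K ?r * ((\<phi> (fst z) - \<phi> (snd z)) / ?r)\<^sup>2 \<le> K ?r * L\<^sup>2"
      by (simp add: kernel_nonneg)
    moreover have "(G \<phi> z)\<^sup>2 = K ?r * ((\<phi> (fst z) - \<phi> (snd z)) / ?r)\<^sup>2"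
      unfolding nonlocal_gradient_def power_mult_distrib by (simp add: kernel_nonneg)
    ultimately show ?thesis by (simp add: mult.commute)
  qed
  then have "integrable (lebesgue_on (S \<times> S)) (\<lambda>z. (G \<phi> z)\<^sup>2)"
    by (intro Bochner_Integration.integrable_bound[OF integrable_mult_right[OF kernel_integrable_pairs, of "L\<^sup>2"]]
        AE_I2) (auto simp: kernel_nonneg)
  then show "G \<phi> \<in> L2_on (S \<times> S)" by (simp add: L2_on_def)
qed

section \<open>The closure of the test functions\<close>

lemma energy_space_0_iff:
  "u \<in> U0 \<longleftrightarrow> u \<in> U \<and> (\<forall>\<epsilon>>0. \<exists>\<phi>\<in>test_functions \<Omega>. energy (\<lambda>x. u x - \<phi> x) < \<epsilon>)"
proof -
  have "(\<forall>\<epsilon>>0. \<exists>\<phi>\<in>test_functions \<Omega>. sqrt (energy (\<lambda>x. u x - \<phi> x)) < \<epsilon>) \<longleftrightarrow>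
      (\<forall>\<epsilon>>0. \<exists>\<phi>\<in>test_functions \<Omega>. energy (\<lambda>x. u x - \<phi> x) < \<epsilon>)" (is "?L \<longleftrightarrow> ?R")
  proof
    assume ?L
    show ?R
    proof (intro allI impI)
      fix \<epsilon> :: real assume "\<epsilon> > 0"
      then obtain \<phi> where "\<phi> \<in> test_functions \<Omega>" "sqrt (energy (\<lambda>x. u x - \<phi> x)) < sqrt \<epsilon>"
        using \<open>?L\<close> by (meson real_sqrt_gt_zero)
      then show "\<exists>\<phi>\<in>test_functions \<Omega>. energy (\<lambda>x. u x - \<phi> x) < \<epsilon>" by auto
    qed
  next
    assume ?R
    show ?L
    proof (intro allI impI)
      fix \<epsilon> :: real assume \<epsilon>: "\<epsilon> > 0"
      then obtain \<phi> where \<phi>: "\<phi> \<in> test_functions \<Omega>" and "energy (\<lambda>x. u x - \<phi> x) < \<epsilon>\<^sup>2"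
        using \<open>?R\<close> by (meson zero_less_power)
      then have "sqrt (energy (\<lambda>x. u x - \<phi> x)) < \<epsilon>"
        using real_sqrt_less_mono[of "energy (\<lambda>x. u x - \<phi> x)" "\<epsilon>\<^sup>2"] \<epsilon> by simp
      then show "\<exists>\<phi>\<in>test_functions \<Omega>. sqrt (energy (\<lambda>x. u x - \<phi> x)) < \<epsilon>"
        using \<phi> by auto
    qed
  qed
  then show ?thesis unfolding energy_space_0_def energy_norm_eq mem_Collect_eq by (rule arg_cong)
qed

lemma energy_space_0_subset: "u \<in> U0 \<Longrightarrow> u \<in> U"
  by (simp add: energy_space_0_iff)

lemma energy_space_0_approx:
  assumes "u \<in> U0" "\<epsilon> > 0"
  obtains \<phi> where "\<phi> \<in> test_functions \<Omega>" "energy (\<lambda>x. u x - \<phi> x) < \<epsilon>"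
  using assms unfolding energy_space_0_iff by blast

lemma energy_space_0_closed:
  assumes w: "w \<in> U" and approx: "\<And>\<epsilon>. \<epsilon> > 0 \<Longrightarrow> \<exists>u\<in>U0. energy (\<lambda>x. w x - u x) \<le> \<epsilon>"
  shows "w \<in> U0"
  unfolding energy_space_0_iff
proof (intro conjI allI impI w)
  fix \<epsilon> :: real assume \<epsilon>: "\<epsilon> > 0"
  obtain u where u: "u \<in> U0" "energy (\<lambda>x. w x - u x) \<le> \<epsilon> / 4" using approx[of "\<epsilon> / 4"] \<epsilon> by auto
  obtain \<phi> where \<phi>: "\<phi> \<in> test_functions \<Omega>" "energy (\<lambda>x. u x - \<phi> x) < \<epsilon> / 4"
    using energy_space_0_approx[OF u(1), of "\<epsilon> / 4"] \<epsilon> by auto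
  have uU: "u \<in> U" using u(1) by (rule energy_space_0_subset)
  have "(\<lambda>x. w x - u x) \<in> U" "(\<lambda>x. u x - \<phi> x) \<in> U"
    using energy_space_lincomb[OF w uU, of 1 "-1"]
      energy_space_lincomb[OF uU test_functions_energy_space[OF \<phi>(1)], of 1 "-1"] by auto
  from energy_lincomb_le[OF this, of 1 1]
  have "energy (\<lambda>x. w x - \<phi> x) \<le> 2 * energy (\<lambda>x. w x - u x) + 2 * energy (\<lambda>x. u x - \<phi> x)"
    by simp
  then have "energy (\<lambda>x. w x - \<phi> x) < \<epsilon>" using u(2) \<phi>(2) by linarith
  then show "\<exists>\<phi>\<in>test_functions \<Omega>. energy (\<lambda>x. w x - \<phi> x) < \<epsilon>" using \<phi>(1) by blast
qed

lemma energy_space_0_lincomb: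
  assumes u: "u \<in> U0" and v: "v \<in> U0"
  shows "(\<lambda>x. a * u x + b * v x) \<in> U0"
  unfolding energy_space_0_iff
proof (intro conjI allI impI)
  have U: "u \<in> U" "v \<in> U" using u v by (auto intro: energy_space_0_subset)
  then show "(\<lambda>x. a * u x + b * v x) \<in> U" by (rule energy_space_lincomb)
  fix \<epsilon> :: real assume \<epsilon>: "\<epsilon> > 0"
  \<comment> \<open>The summand \<open>1\<close> keeps the denominator positive when both coefficients vanish.\<close>
  define \<eta> where "\<eta> = \<epsilon> / (2 * a\<^sup>2 + 2 * b\<^sup>2 + 1)"
  have den: "2 * a\<^sup>2 + 2 * b\<^sup>2 + 1 > 0" by (simp add: add_nonneg_pos)
  then have \<eta>: "\<eta> > 0" using \<epsilon> by (simp add: \<eta>_def)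
  obtain \<phi> where \<phi>: "\<phi> \<in> test_functions \<Omega>" "energy (\<lambda>x. u x - \<phi> x) < \<eta>"
    by (rule energy_space_0_approx[OF u \<eta>])
  obtain \<psi> where \<psi>: "\<psi> \<in> test_functions \<Omega>" "energy (\<lambda>x. v x - \<psi> x) < \<eta>"
    by (rule energy_space_0_approx[OF v \<eta>])
  have "(\<lambda>x. u x - \<phi> x) \<in> U" "(\<lambda>x. v x - \<psi> x) \<in> U"
    using energy_space_lincomb[OF U(1) test_functions_energy_space[OF \<phi>(1)], of 1 "-1"]
      energy_space_lincomb[OF U(2) test_functions_energy_space[OF \<psi>(1)], of 1 "-1"] by auto
  from energy_lincomb_le[OF this, of a b]
  have "energy (\<lambda>x. (a * u x + b * v x) - (a * \<phi> x + b * \<psi> x)) \<le>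
      2 * a\<^sup>2 * energy (\<lambda>x. u x - \<phi> x) + 2 * b\<^sup>2 * energy (\<lambda>x. v x - \<psi> x)"
    by (simp add: algebra_simps)
  also have "\<dots> \<le> 2 * a\<^sup>2 * \<eta> + 2 * b\<^sup>2 * \<eta>"
    using \<phi>(2) \<psi>(2) by (intro add_mono mult_left_mono) auto
  also have "\<dots> < \<eta> * (2 * a\<^sup>2 + 2 * b\<^sup>2 + 1)"
    using \<eta> by (simp add: algebra_simps)
  also have "\<dots> = \<epsilon>" using den by (simp add: \<eta>_def)
  finally show "\<exists>\<phi>\<in>test_functions \<Omega>. energy (\<lambda>x. (a * u x + b * v x) - \<phi> x) < \<epsilon>"
    using test_functions_lincomb[OF \<phi>(1) \<psi>(1), of a b]
    by (intro bexI[where x = "\<lambda>x. a * \<phi> x + b * \<psi> x"])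
qed

lemma energy_minus_commute: "energy (\<lambda>x. u x - v x) = energy (\<lambda>x. v x - u x)"
  unfolding energy_def sqint_def nonlocal_gradient_diff by (simp add: power2_commute)

lemma zero_energy_space_0: "(\<lambda>_. 0) \<in> U0"
proof -
  have "energy (\<lambda>_. 0) = 0" by (simp add: energy_def sqint_def nonlocal_gradient_def)
  then show ?thesis
    unfolding energy_space_0_iff
    using test_functions_energy_space[OF zero_test_function] zero_test_function
    by (auto intro!: bexI[of _ "\<lambda>_. 0"])
qed

end

section \<open>A nonlocal Poincare inequality\<close>

lemma square_le_sum_increments:
  fixes \<phi> :: "'a::real_vector \<Rightarrow> real"
  assumes "\<phi> (x + real N *\<^sub>R h) = 0"
  shows "(\<phi> x)\<^sup>2 \<le> real N * (\<Sum>k<N. (\<phi> (x + real (Suc k) *\<^sub>R h) - \<phi> (x + real k *\<^sub>R h))\<^sup>2)"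
proof -
  have "(\<Sum>k<N. \<phi> (x + real (Suc k) *\<^sub>R h) - \<phi> (x + real k *\<^sub>R h)) = - \<phi> x"
    using sum_lessThan_telescope[of "\<lambda>k. \<phi> (x + real k *\<^sub>R h)" N] assms by simp
  then have "(\<phi> x)\<^sup>2 = (\<Sum>k<N. \<phi> (x + real (Suc k) *\<^sub>R h) - \<phi> (x + real k *\<^sub>R h))\<^sup>2"
    by simp
  also have "\<dots> \<le> (\<Sum>k<N. (\<phi> (x + real (Suc k) *\<^sub>R h) - \<phi> (x + real k *\<^sub>R h))\<^sup>2) * real (card {..<N})"
    by (rule sum_squared_le_sum_of_squares)
  finally show ?thesis by (simp add: mult.commute)
qed

context nonlocal_domain
begin

text \<open>
  \<open>N\<close> steps along \<open>h\<close> leave the domain, where the function vanishes. All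
  \<open>N\<close> increments have the same square integral by translation invariance, and the
  Cauchy--Schwarz inequality for sums costs another factor \<open>N\<close>.
\<close>
lemma nn_integral_square_le_shift:
  assumes \<phi>: "\<phi> \<in> test_functions \<Omega>" and exit: "\<And>x. x \<in> \<Omega> \<Longrightarrow> x + real N *\<^sub>R h \<notin> \<Omega>"
  shows "(\<integral>\<^sup>+x. ennreal ((\<phi> x)\<^sup>2) \<partial>lborel) \<le>
    ennreal ((real N)\<^sup>2) * (\<integral>\<^sup>+x. ennreal ((\<phi> (x + h) - \<phi> x)\<^sup>2) \<partial>lborel)"
proof -
  have [measurable]: "\<phi> \<in> borel_measurable borel" by (rule test_function_measurable(1)[OF \<phi>])
  let ?d = "\<lambda>k x. ennreal ((\<phi> (x + real (Suc k) *\<^sub>R h) - \<phi> (x + real k *\<^sub>R h))\<^sup>2)"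
  have "(\<integral>\<^sup>+x. ennreal ((\<phi> x)\<^sup>2) \<partial>lborel) \<le> (\<integral>\<^sup>+x. ennreal (real N) * (\<Sum>k<N. ?d k x) \<partial>lborel)"
  proof (rule nn_integral_mono)
    fix x
    have "(\<phi> x)\<^sup>2 \<le> real N * (\<Sum>k<N. (\<phi> (x + real (Suc k) *\<^sub>R h) - \<phi> (x + real k *\<^sub>R h))\<^sup>2)"
    proof (cases "x \<in> \<Omega>")
      case True
      show ?thesis
        by (rule square_le_sum_increments) (rule test_function_zero_outside[OF \<phi> exit[OF True]])
    next
      case False
      then show ?thesis using test_function_zero_outside[OF \<phi> False] by (simp add: sum_nonneg)
    qed
    then show "ennreal ((\<phi> x)\<^sup>2) \<le> ennreal (real N) * (\<Sum>k<N. ?d k x)"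
      by (simp add: ennreal_mult[symmetric] sum_nonneg ennreal_leI)
  qed
  also have "\<dots> = ennreal (real N) * (\<integral>\<^sup>+x. (\<Sum>k<N. ?d k x) \<partial>lborel)"
    by (rule nn_integral_cmult) measurable
  also have "(\<integral>\<^sup>+x. (\<Sum>k<N. ?d k x) \<partial>lborel) = (\<Sum>k<N. \<integral>\<^sup>+x. ?d k x \<partial>lborel)"
    by (rule nn_integral_sum) measurable
  also have "(\<Sum>k<N. \<integral>\<^sup>+x. ?d k x \<partial>lborel) =
      (\<Sum>k<N. \<integral>\<^sup>+x. ennreal ((\<phi> (x + h) - \<phi> x)\<^sup>2) \<partial>lborel)"
  proof (rule sum.cong[OF refl])
    fix k
    have "(\<integral>\<^sup>+x. ?d k x \<partial>lborel) =
        (\<integral>\<^sup>+x. ennreal ((\<phi> ((real k *\<^sub>R h + x) + h) - \<phi> (real k *\<^sub>R h + x))\<^sup>2) \<partial>lborel)"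
      by (simp add: algebra_simps)
    also have "\<dots> = (\<integral>\<^sup>+x. ennreal ((\<phi> (x + h) - \<phi> x)\<^sup>2) \<partial>lborel)"
      by (rule nn_integral_lborel_translate[of "\<lambda>x. ennreal ((\<phi> (x + h) - \<phi> x)\<^sup>2)"]) measurable
    finally show "(\<integral>\<^sup>+x. ?d k x \<partial>lborel) = (\<integral>\<^sup>+x. ennreal ((\<phi> (x + h) - \<phi> x)\<^sup>2) \<partial>lborel)" .
  qed
  also have "ennreal (real N) * \<dots> =
      ennreal ((real N)\<^sup>2) * (\<integral>\<^sup>+x. ennreal ((\<phi> (x + h) - \<phi> x)\<^sup>2) \<partial>lborel)"
    by (simp add: power2_eq_square ennreal_mult ennreal_of_nat_eq_real_of_nat mult.assoc)
  finally show ?thesis .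
qed

text \<open>
  The shift inequality is averaged over a small ball \<open>H\<close> of shifts, chosen inside the
  annulus where the kernel is bounded below, so that the same number \<open>N\<close> of steps works
  for every \<open>h\<close> in \<open>H\<close>. Fubini and the substitution \<open>y = x + h\<close> turn the average
  into a double integral of squared increments. An increment is nonzero only if one of the
  two points lies in the domain, and then both lie in \<open>S\<close>, because \<open>h\<close> is shorter than \<open>\<delta>\<close>;
  so the double integral is controlled by the energy.
\<close>
lemma Poincare_test_functions:
  obtains C where "0 \<le> C"
    and "\<And>\<phi>. \<phi> \<in> test_functions \<Omega> \<Longrightarrow> sqint S \<phi> \<le> C * sqint (S \<times> S) (G \<phi>)"
proof -
  obtain c where c: "c > 0" and K_lower: "\<And>h::'a. \<delta> / 4 \<le> norm h \<Longrightarrow> norm h < \<delta> / 2 \<Longrightarrow>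
      c \<le> K (norm h) / (norm h)\<^sup>2"
    using kernel_bounded_below by blast
  obtain R where R: "\<And>x. x \<in> \<Omega> \<Longrightarrow> norm x \<le> R"
    using bounded_domain by (auto simp: bounded_iff)
  obtain b :: 'a where b: "b \<in> Basis" using nonempty_Basis by blast
  \<comment> \<open>The ball of radius \<open>\<delta> / 8\<close> around a point of norm \<open>3 \<delta> / 8\<close> lies in the annulus.\<close>
  define p where "p = (3 * \<delta> / 8) *\<^sub>R b"
  define H where "H = ball p (\<delta> / 8)"
  have norm_p: "norm p = 3 * \<delta> / 8" using b \<delta>_pos by (simp add: p_def)
  have H: "\<delta> / 4 \<le> norm h" "norm h < \<delta> / 2" if "h \<in> H" for h
    using that norm_triangle_ineq2[of p h] norm_triangle_ineq2[of h p] norm_p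
    by (auto simp: H_def dist_norm norm_minus_commute)
  define m where "m = measure lborel H"
  have m: "m > 0" using \<delta>_pos by (simp add: m_def H_def content_ball_pos)
  have Hm: "emeasure lborel H = ennreal m"
    using emeasure_eq_ennreal_measure[of lborel H] emeasure_bounded_finite[of H]
    by (simp add: m_def H_def)
  \<comment> \<open>\<open>N\<close> steps, each of length at least \<open>\<delta> / 4\<close>, exceed the diameter of the domain.\<close>
  obtain N :: nat where N: "2 * R < real N * (\<delta> / 4)"
    using reals_Archimedean3[of "\<delta> / 4", rule_format, of "2 * R"] \<delta>_pos by fastforce
  have exit: "x + real N *\<^sub>R h \<notin> \<Omega>" if "h \<in> H" "x \<in> \<Omega>" for x h
  proof
    assume "x + real N *\<^sub>R h \<in> \<Omega>"
    then have "norm (real N *\<^sub>R h) \<le> 2 * R"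
      using R[OF that(2)] R[of "x + real N *\<^sub>R h"] norm_triangle_ineq4[of "x + real N *\<^sub>R h" x]
      by simp
    moreover have "real N * (\<delta> / 4) \<le> real N * norm h"
      by (rule mult_left_mono[OF H(1)[OF that(1)]]) simp
    then have "real N * (\<delta> / 4) \<le> norm (real N *\<^sub>R h)" by simp
    ultimately show False using N by linarith
  qed
  show ?thesis
  proof
    show "0 \<le> (real N)\<^sup>2 / (c * m)" using c m by simp
    fix \<phi> assume \<phi>: "\<phi> \<in> test_functions \<Omega>"
    have [measurable]: "\<phi> \<in> borel_measurable borel" by (rule test_function_measurable(1)[OF \<phi>])
    have [measurable]: "H \<in> sets borel" by (simp add: H_def)
    have \<phi>U: "\<phi> \<in> U" by (rule test_functions_energy_space[OF \<phi>])
    let ?I = "\<integral>\<^sup>+x. ennreal ((\<phi> x)\<^sup>2) \<partial>lborel"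
    let ?D = "\<lambda>x y. ennreal ((\<phi> y - \<phi> x)\<^sup>2) * indicator H (y - x)"
    have I: "?I = ennreal (sqint S \<phi>)"
    proof -
      have "?I = (\<integral>\<^sup>+x. ennreal ((\<phi> x)\<^sup>2) * indicator S x \<partial>lebesgue)"
        unfolding nn_integral_completion
      proof (rule nn_integral_cong)
        fix x show "ennreal ((\<phi> x)\<^sup>2) = ennreal ((\<phi> x)\<^sup>2) * indicator S x"
          using test_function_zero_outside[OF \<phi>, of x] domain_subset_S by (cases "x \<in> S") auto
      qed
      also have "\<dots> = (\<integral>\<^sup>+x. ennreal ((\<phi> x)\<^sup>2) \<partial>lebesgue_on S)"
        using sets_lebesgue_S by (simp add: nn_integral_restrict_space)
      also have "\<dots> = ennreal (sqint S \<phi>)"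
        using energy_spaceD(1)[OF \<phi>U] unfolding sqint_def
        by (intro nn_integral_eq_integral) (auto simp: L2_on_def)
      finally show ?thesis .
    qed
    have "ennreal m * ?I = ?I * emeasure lborel H" by (simp only: Hm mult.commute)
    also have "\<dots> = (\<integral>\<^sup>+h. ?I * indicator H h \<partial>lborel)"
      by (rule nn_integral_cmult_indicator[symmetric]) (simp add: H_def)
    also have "\<dots> \<le> (\<integral>\<^sup>+h. ennreal ((real N)\<^sup>2) *
        (\<integral>\<^sup>+x. ennreal ((\<phi> (x + h) - \<phi> x)\<^sup>2) * indicator H h \<partial>lborel) \<partial>lborel)"
    proof (rule nn_integral_mono)
      fix h :: 'a
      show "?I * indicator H h \<le> ennreal ((real N)\<^sup>2) *
          (\<integral>\<^sup>+x. ennreal ((\<phi> (x + h) - \<phi> x)\<^sup>2) * indicator H h \<partial>lborel)"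
        using nn_integral_square_le_shift[OF \<phi> exit, of h] by (cases "h \<in> H") auto
    qed
    also have "\<dots> = ennreal ((real N)\<^sup>2) *
        (\<integral>\<^sup>+h. \<integral>\<^sup>+x. ennreal ((\<phi> (x + h) - \<phi> x)\<^sup>2) * indicator H h \<partial>lborel \<partial>lborel)"
      by (rule nn_integral_cmult) measurable
    finally have 1: "ennreal m * ?I \<le> ennreal ((real N)\<^sup>2) *
        (\<integral>\<^sup>+h. \<integral>\<^sup>+x. ennreal ((\<phi> (x + h) - \<phi> x)\<^sup>2) * indicator H h \<partial>lborel \<partial>lborel)" .
    have "(\<integral>\<^sup>+h. \<integral>\<^sup>+x. ennreal ((\<phi> (x + h) - \<phi> x)\<^sup>2) * indicator H h \<partial>lborel \<partial>lborel) =
        (\<integral>\<^sup>+x. \<integral>\<^sup>+h. ennreal ((\<phi> (x + h) - \<phi> x)\<^sup>2) * indicator H h \<partial>lborel \<partial>lborel)"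
      by (rule lborel_pair.Fubini') measurable
    also have "\<dots> = (\<integral>\<^sup>+x. \<integral>\<^sup>+y. ?D x y \<partial>lborel \<partial>lborel)"
    proof (rule nn_integral_cong)
      fix x
      show "(\<integral>\<^sup>+h. ennreal ((\<phi> (x + h) - \<phi> x)\<^sup>2) * indicator H h \<partial>lborel) = (\<integral>\<^sup>+y. ?D x y \<partial>lborel)"
        using nn_integral_lborel_translate[of "?D x" x] by simp
    qed
    also have "\<dots> = (\<integral>\<^sup>+z. ?D (fst z) (snd z) \<partial>(lborel \<Otimes>\<^sub>M lborel))"
      by (subst lborel.nn_integral_fst[symmetric]) auto
    also have "\<dots> = (\<integral>\<^sup>+z. ?D (fst z) (snd z) \<partial>lebesgue)"
      by (simp add: lborel_prod nn_integral_completion)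
    also have "\<dots> \<le> (\<integral>\<^sup>+z. ennreal (1 / c * (G \<phi> z)\<^sup>2) * indicator (S \<times> S) z \<partial>lebesgue)"
    proof (rule nn_integral_mono)
      fix z :: "'a \<times> 'a"
      obtain x y where z: "z = (x, y)" by force
      show "?D (fst z) (snd z) \<le> ennreal (1 / c * (G \<phi> z)\<^sup>2) * indicator (S \<times> S) z"
      proof (cases "y - x \<in> H \<and> \<phi> x \<noteq> \<phi> y")
        case True
        then have h: "\<delta> / 4 \<le> norm (x - y)" "norm (x - y) < \<delta> / 2"
          using H[of "y - x"] by (auto simp: norm_minus_commute)
        have "x \<in> \<Omega> \<or> y \<in> \<Omega>"
          using True test_function_zero_outside[OF \<phi>] by metis
        then have xy: "x \<in> S" "y \<in> S"
          using near_domain_in_S[of x y] near_domain_in_S[of y x] domain_subset_S h \<delta>_pos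
          by (auto simp: norm_minus_commute)
        have "c * (\<phi> y - \<phi> x)\<^sup>2 \<le> K (norm (x - y)) / (norm (x - y))\<^sup>2 * (\<phi> y - \<phi> x)\<^sup>2"
          using K_lower[OF h] by (intro mult_right_mono) auto
        also have "\<dots> = (G \<phi> z)\<^sup>2"
          by (simp add: z nonlocal_gradient_def power_mult_distrib power_divide kernel_nonneg
              power2_commute)
        finally have "(\<phi> y - \<phi> x)\<^sup>2 \<le> 1 / c * (G \<phi> z)\<^sup>2" using c by (simp add: field_simps)
        then show ?thesis using xy True by (simp add: z ennreal_leI)
      qed (auto simp: z)
    qed
    also have "\<dots> = (\<integral>\<^sup>+z. ennreal (1 / c * (G \<phi> z)\<^sup>2) \<partial>lebesgue_on (S \<times> S))"
      using sets_lebesgue_S by (simp add: nn_integral_restrict_space)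
    also have "\<dots> = ennreal (1 / c * sqint (S \<times> S) (G \<phi>))"
      using energy_spaceD(2)[OF \<phi>U] c unfolding sqint_def
      by (subst nn_integral_eq_integral) (auto simp: L2_on_def)
    finally have "ennreal ((real N)\<^sup>2) *
        (\<integral>\<^sup>+h. \<integral>\<^sup>+x. ennreal ((\<phi> (x + h) - \<phi> x)\<^sup>2) * indicator H h \<partial>lborel \<partial>lborel) \<le>
        ennreal ((real N)\<^sup>2) * ennreal (1 / c * sqint (S \<times> S) (G \<phi>))"
      by (rule mult_left_mono) simp
    with 1 have "ennreal m * ennreal (sqint S \<phi>) \<le>
        ennreal ((real N)\<^sup>2) * ennreal (1 / c * sqint (S \<times> S) (G \<phi>))"
      unfolding I by (rule order_trans)
    then have "ennreal (m * sqint S \<phi>) \<le> ennreal ((real N)\<^sup>2 * (1 / c * sqint (S \<times> S) (G \<phi>)))"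
      using m c sqint_nonneg[of S \<phi>] sqint_nonneg[of "S \<times> S" "G \<phi>"]
      by (subst (1 2) ennreal_mult) auto
    then have "m * sqint S \<phi> \<le> (real N)\<^sup>2 * (1 / c * sqint (S \<times> S) (G \<phi>))"
      using c sqint_nonneg[of "S \<times> S" "G \<phi>"] by (subst (asm) ennreal_le_iff) auto
    then show "sqint S \<phi> \<le> (real N)\<^sup>2 / (c * m) * sqint (S \<times> S) (G \<phi>)"
      using m c by (simp add: field_simps)
  qed
qed

text \<open>Both sides are continuous for the energy norm, so the inequality passes to the closure.\<close>
lemma Poincare:
  obtains C where "C > 0"
    and "\<And>u. u \<in> U0 \<Longrightarrow> sqint S u \<le> C * sqint (S \<times> S) (G u)"
proof -
  obtain C where C: "0 \<le> C"
    "\<And>\<phi>. \<phi> \<in> test_functions \<Omega> \<Longrightarrow> sqint S \<phi> \<le> C * sqint (S \<times> S) (G \<phi>)"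
    using Poincare_test_functions by blast
  show ?thesis
  proof
    show "4 * C + 1 > 0" using C(1) by simp
    fix u assume u: "u \<in> U0"
    then have uU: "u \<in> U" by (rule energy_space_0_subset)
    have "sqint S u \<le> 4 * C * sqint (S \<times> S) (G u) + e" if "e > 0" for e
    proof -
      define \<epsilon> where "\<epsilon> = e / (2 + 4 * C)"
      have \<epsilon>: "\<epsilon> > 0" using that C(1) by (simp add: \<epsilon>_def)
      obtain \<phi> where \<phi>: "\<phi> \<in> test_functions \<Omega>" "energy (\<lambda>x. u x - \<phi> x) < \<epsilon>"
        by (rule energy_space_0_approx[OF u \<epsilon>])
      have \<phi>U: "\<phi> \<in> U" by (rule test_functions_energy_space[OF \<phi>(1)])
      let ?w = "\<lambda>x. u x - \<phi> x"
      have wU: "?w \<in> U" using energy_space_lincomb[OF uU \<phi>U, of 1 "-1"] by simp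
      have w: "sqint S ?w \<le> \<epsilon>" "sqint (S \<times> S) (G ?w) \<le> \<epsilon>"
        using \<phi>(2) sqint_nonneg[of S ?w] sqint_nonneg[of "S \<times> S" "G ?w"]
        unfolding energy_def by linarith+
      have "sqint S u \<le> 2 * sqint S ?w + 2 * sqint S \<phi>"
        using sqint_lincomb_le[OF energy_spaceD(1)[OF wU] energy_spaceD(1)[OF \<phi>U], of 1 1] by simp
      moreover have "sqint (S \<times> S) (G \<phi>) \<le> 2 * sqint (S \<times> S) (G u) + 2 * sqint (S \<times> S) (G ?w)"
        using sqint_lincomb_le[OF energy_spaceD(2)[OF uU] energy_spaceD(2)[OF wU], of 1 "-1"]
        unfolding nonlocal_gradient_diff by simp
      then have "C * sqint (S \<times> S) (G \<phi>) \<le> C * (2 * sqint (S \<times> S) (G u) + 2 * \<epsilon>)"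
        using w(2) C(1) by (intro mult_left_mono) auto
      ultimately have "sqint S u \<le> 2 * \<epsilon> + 2 * (C * (2 * sqint (S \<times> S) (G u) + 2 * \<epsilon>))"
        using C(2)[OF \<phi>(1)] w(1) by linarith
      also have "\<dots> = 4 * C * sqint (S \<times> S) (G u) + \<epsilon> * (2 + 4 * C)" by (simp add: algebra_simps)
      also have "\<epsilon> * (2 + 4 * C) = e" using C(1) by (simp add: \<epsilon>_def)
      finally show ?thesis .
    qed
    then have "sqint S u \<le> 4 * C * sqint (S \<times> S) (G u)" by (rule field_le_epsilon)
    then show "sqint S u \<le> (4 * C + 1) * sqint (S \<times> S) (G u)"
      using sqint_nonneg[of "S \<times> S" "G u"] by (simp add: algebra_simps)
  qed
qed

section \<open>The state equation\<close>

lemma L2_on_domain: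
  assumes "v \<in> L2_on S"
  shows "v \<in> L2_on \<Omega>" "sqint \<Omega> v \<le> sqint S v"
  using L2_on_subset[OF assms domain_subset_S sets_lebesgue_S(1,2)] by auto

lemma load_lincomb:
  assumes f: "f \<in> L2_on \<Omega>" and u: "u \<in> U" and v: "v \<in> U"
  shows "load \<Omega> f (\<lambda>x. a * u x + b * v x) = a * load \<Omega> f u + b * load \<Omega> f v"
proof -
  have int: "integrable (lebesgue_on \<Omega>) (\<lambda>x. f x * u x)" "integrable (lebesgue_on \<Omega>) (\<lambda>x. f x * v x)"
    using u v by (auto intro!: L2_on_integrable_mult f L2_on_domain energy_spaceD)
  have "(\<lambda>x. f x * (a * u x + b * v x)) = (\<lambda>x. a * (f x * u x) + b * (f x * v x))"
    by (auto simp: algebra_simps)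
  then show ?thesis unfolding load_def using int by simp
qed

text \<open>Young's inequality, from the square of \<open>\<surd>t v - f / \<surd>t\<close>.\<close>
lemma load_le:
  assumes f: "f \<in> L2_on \<Omega>" and v: "v \<in> L2_on S" and t: "t > 0"
  shows "2 * load \<Omega> f v \<le> t * sqint S v + sqint \<Omega> f / t"
proof -
  have v': "v \<in> L2_on \<Omega>" "sqint \<Omega> v \<le> sqint S v" by (rule L2_on_domain[OF v])+
  have "0 \<le> sqint \<Omega> (\<lambda>x. sqrt t * v x + (- 1 / sqrt t) * f x)" by (rule sqint_nonneg)
  also have "\<dots> = t * sqint \<Omega> v - 2 * load \<Omega> f v + sqint \<Omega> f / t"
    unfolding sqint_lincomb[OF v'(1) f] load_def using t
    by (simp add: power_divide mult.commute)
  finally have "2 * load \<Omega> f v \<le> t * sqint \<Omega> v + sqint \<Omega> f / t" by linarith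
  also have "t * sqint \<Omega> v \<le> t * sqint S v" using v'(2) t by (intro mult_left_mono) auto
  finally show ?thesis by simp
qed

text \<open>
  The bound depends on the lower ellipticity constant only. It bounds the energy functional from
  below and shows that some sublevel set of the compliance is nonempty.
\<close>
lemma dual_energy_bounded:
  assumes f: "f \<in> L2_on \<Omega>" and "0 < lo"
  obtains B where "\<And>hi \<kappa> v. elliptic lo hi \<kappa> \<Longrightarrow> v \<in> U0 \<Longrightarrow> 2 * load \<Omega> f v - form \<kappa> v v \<le> B"
proof -
  obtain C where C: "C > 0" "\<And>u. u \<in> U0 \<Longrightarrow> sqint S u \<le> C * sqint (S \<times> S) (G u)"
    using Poincare by blast
  show ?thesis
  proof
    fix hi \<kappa> v assume \<kappa>: "elliptic lo hi \<kappa>" and v: "v \<in> U0"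
    have vU: "v \<in> U" using v by (rule energy_space_0_subset)
    have "lo / C * sqint S v \<le> lo / C * (C * sqint (S \<times> S) (G v))"
      using C(1) assms(2) by (intro mult_left_mono C(2) v) auto
    also have "\<dots> = lo * sqint (S \<times> S) (G v)" using C(1) by simp
    also have "\<dots> \<le> form \<kappa> v v" by (rule form_lower[OF \<kappa> vU])
    finally have "lo / C * sqint S v \<le> form \<kappa> v v" .
    then show "2 * load \<Omega> f v - form \<kappa> v v \<le> sqint \<Omega> f / (lo / C)"
      using load_le[OF f energy_spaceD(1)[OF vU], of "lo / C"] C(1) assms(2) by simp
  qed
qed

lemma coercive:
  assumes "0 < lo"
  obtains M where "M > 0" "\<And>hi \<kappa> u. elliptic lo hi \<kappa> \<Longrightarrow> u \<in> U0 \<Longrightarrow> energy u \<le> M * form \<kappa> u u"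
proof -
  obtain C where C: "C > 0" "\<And>u. u \<in> U0 \<Longrightarrow> sqint S u \<le> C * sqint (S \<times> S) (G u)"
    using Poincare by blast
  show ?thesis
  proof
    show "(C + 1) / lo > 0" using C(1) assms by simp
    fix hi \<kappa> u assume \<kappa>: "elliptic lo hi \<kappa>" and u: "u \<in> U0"
    have "energy u \<le> (C + 1) * sqint (S \<times> S) (G u)"
      using C(2)[OF u] by (simp add: energy_def algebra_simps)
    also have "\<dots> = (C + 1) / lo * (lo * sqint (S \<times> S) (G u))" using assms by simp
    also have "\<dots> \<le> (C + 1) / lo * form \<kappa> u u"
      using C(1) assms by (intro mult_left_mono form_lower[OF \<kappa> energy_space_0_subset[OF u]]) auto
    finally show "energy u \<le> (C + 1) / lo * form \<kappa> u u" .
  qed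
qed

text \<open>
  Riesz representation by minimizing \<open>J\<close>. For this quadratic functional the midpoint gap
  is exactly a quarter of the form of the difference, so coercivity makes an almost minimizing
  sequence Cauchy. Almost minimality gives approximate equations for the
  members of the sequence, and these pass to the limit \<open>w\<close> by the Cauchy--Schwarz inequality.
\<close>
lemma state_equation_solvable:
  assumes \<kappa>: "elliptic lo hi \<kappa>" and f: "f \<in> L2_on \<Omega>"
  obtains u where "u \<in> U0" "\<And>v. v \<in> U0 \<Longrightarrow> form \<kappa> u v = load \<Omega> f v"
proof -
  have lo: "0 < lo" and hi: "0 < hi" using \<kappa> by (auto simp: elliptic_def)
  define J where "J v = form \<kappa> v v - 2 * load \<Omega> f v" for v
  have J_lincomb: "J (\<lambda>x. a * u x + b * v x) = a\<^sup>2 * form \<kappa> u u + 2 * a * b * form \<kappa> u v +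
      b\<^sup>2 * form \<kappa> v v - 2 * (a * load \<Omega> f u + b * load \<Omega> f v)" if "u \<in> U0" "v \<in> U0" for a b u v
    unfolding J_def form_lincomb_square[OF \<kappa> energy_space_0_subset[OF that(1)] energy_space_0_subset[OF that(2)]]
      load_lincomb[OF f energy_space_0_subset[OF that(1)] energy_space_0_subset[OF that(2)]] ..
  obtain B where B: "\<And>v. v \<in> U0 \<Longrightarrow> 2 * load \<Omega> f v - form \<kappa> v v \<le> B"
    using dual_energy_bounded[OF f lo] \<kappa> by metis
  obtain M where M: "M > 0" "\<And>u. u \<in> U0 \<Longrightarrow> energy u \<le> M * form \<kappa> u u"
    using coercive[OF lo] \<kappa> by metis
  have diff: "(\<lambda>x. u x - v x) \<in> U0" if "u \<in> U0" "v \<in> U0" for u v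
    using energy_space_0_lincomb[OF that, of 1 "-1"] by simp
  obtain u :: "nat \<Rightarrow> 'a \<Rightarrow> real" where u: "\<And>k. u k \<in> U0"
    and u_min: "\<And>k y. y \<in> U0 \<Longrightarrow> J (u k) \<le> J y + 1 / real (Suc k)"
    and Cauchy: "\<And>\<epsilon>. \<epsilon> > 0 \<Longrightarrow> \<exists>N. \<forall>j\<ge>N. \<forall>k\<ge>N.
      form \<kappa> (\<lambda>x. u j x - u k x) (\<lambda>x. u j x - u k x) / 4 < \<epsilon>"
  proof (rule midpoint_minimizing_sequence[of "\<lambda>_. U0" "- B" J "J (\<lambda>_. 0)"
        "\<lambda>u v x. 1 / 2 * u x + 1 / 2 * v x"
        "\<lambda>u v. form \<kappa> (\<lambda>x. u x - v x) (\<lambda>x. u x - v x) / 4"])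
    show "- B \<le> J v" if "v \<in> U0" for v using B[OF that] by (simp add: J_def)
    show "\<exists>v\<in>U0. J v \<le> J (\<lambda>_. 0)" using zero_energy_space_0 by blast
    show "(\<lambda>x. 1 / 2 * u x + 1 / 2 * v x) \<in> U0" if "u \<in> U0" "v \<in> U0" for u v
      by (rule energy_space_0_lincomb[OF that])
    show "form \<kappa> (\<lambda>x. u x - v x) (\<lambda>x. u x - v x) / 4 \<le>
        (J u + J v) / 2 - J (\<lambda>x. 1 / 2 * u x + 1 / 2 * v x)" if "u \<in> U0" "v \<in> U0" for u v
    proof -
      have "form \<kappa> (\<lambda>x. u x - v x) (\<lambda>x. u x - v x) = form \<kappa> u u - 2 * form \<kappa> u v + form \<kappa> v v"
        using form_lincomb_square[OF \<kappa> energy_space_0_subset[OF that(1)]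
            energy_space_0_subset[OF that(2)], of 1 "-1"] by simp
      then show ?thesis
        unfolding J_lincomb[OF that] by (simp add: J_def power2_eq_square field_simps)
    qed
  qed (auto simp del: One_nat_def)
  have "\<exists>N. \<forall>j\<ge>N. \<forall>k\<ge>N. energy (\<lambda>x. u j x - u k x) < \<epsilon>" if \<epsilon>: "\<epsilon> > 0" for \<epsilon>
  proof -
    obtain N where N: "\<forall>j\<ge>N. \<forall>k\<ge>N.
        form \<kappa> (\<lambda>x. u j x - u k x) (\<lambda>x. u j x - u k x) / 4 < \<epsilon> / (4 * M)"
      using Cauchy[of "\<epsilon> / (4 * M)"] \<epsilon> M(1) by auto
    have "energy (\<lambda>x. u j x - u k x) < \<epsilon>" if "j \<ge> N" "k \<ge> N" for j k
    proof -
      have "energy (\<lambda>x. u j x - u k x) \<le> M * form \<kappa> (\<lambda>x. u j x - u k x) (\<lambda>x. u j x - u k x)"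
        by (rule M(2)[OF diff[OF u u]])
      moreover have "form \<kappa> (\<lambda>x. u j x - u k x) (\<lambda>x. u j x - u k x) / 4 < \<epsilon> / (4 * M)"
        using N that by blast
      then have "M * form \<kappa> (\<lambda>x. u j x - u k x) (\<lambda>x. u j x - u k x) < \<epsilon>"
        using M(1) by (simp add: field_simps)
      ultimately show ?thesis by linarith
    qed
    then show ?thesis by blast
  qed
  from energy_space_complete[OF energy_space_0_subset[OF u] this]
  obtain w where w: "w \<in> U"
    and lim: "\<And>\<epsilon>. \<epsilon> > 0 \<Longrightarrow> \<exists>N. \<forall>k\<ge>N. energy (\<lambda>x. u k x - w x) \<le> \<epsilon>"
    by blast
  have w0: "w \<in> U0"
  proof (rule energy_space_0_closed[OF w])
    fix \<epsilon> :: real assume "\<epsilon> > 0"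
    then obtain N where "energy (\<lambda>x. u N x - w x) \<le> \<epsilon>" using lim by blast
    then show "\<exists>u\<in>U0. energy (\<lambda>x. w x - u x) \<le> \<epsilon>"
      using u[of N] by (intro bexI[of _ "u N"]) (simp_all add: energy_minus_commute[of w])
  qed
  show ?thesis
  proof
    show "w \<in> U0" by (rule w0)
    fix v assume v: "v \<in> U0"
    have vU: "v \<in> U" by (rule energy_space_0_subset[OF v])
    let ?F = "form \<kappa> v v"
    have F: "0 \<le> ?F" by (rule form_nonneg[OF \<kappa> vU])
    \<comment> \<open>Testing near-minimality in the direction \<open>v\<close> gives a quadratic in \<open>t\<close> that is almost
      nonnegative, hence an almost vanishing linear coefficient.\<close>
    have near: "(form \<kappa> (u k) v - load \<Omega> f v)\<^sup>2 \<le> ?F * (1 / real (Suc k))" for k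
    proof (rule nonneg_quadratic_discriminant[OF _ F])
      fix t
      have "J (u k) \<le> J (\<lambda>x. 1 * u k x + t * v x) + 1 / real (Suc k)"
        by (rule u_min[OF energy_space_0_lincomb[OF u v]])
      then show "0 \<le> ?F * t\<^sup>2 + 2 * (form \<kappa> (u k) v - load \<Omega> f v) * t + 1 / real (Suc k)"
        unfolding J_lincomb[OF u v] by (simp add: J_def algebra_simps)
    qed
    have "(form \<kappa> w v - load \<Omega> f v)\<^sup>2 \<le> e * (2 * (hi * ?F) + 2 * ?F)" if e: "e > 0" for e
    proof -
      obtain N1 where N1: "\<forall>k\<ge>N1. energy (\<lambda>x. u k x - w x) \<le> e" using lim[OF e] by blast
      obtain N2 where N2: "1 / real (Suc N2) < e" using e nat_approx_posE by blast
      define k where "k = max N1 N2"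
      let ?d = "\<lambda>x. u k x - w x"
      have d: "?d \<in> U" by (rule energy_space_0_subset[OF diff[OF u w0]])
      have "form \<kappa> ?d v = form \<kappa> (u k) v - form \<kappa> w v"
        using form_lincomb_left[OF \<kappa> energy_space_0_subset[OF u] w vU, of 1 k "-1"] by simp
      then have "(form \<kappa> (u k) v - form \<kappa> w v)\<^sup>2 \<le> form \<kappa> ?d ?d * ?F"
        using form_Cauchy_Schwarz[OF \<kappa> d vU] by simp
      also have "\<dots> \<le> (hi * e) * ?F"
      proof (rule mult_right_mono[OF _ F])
        have "form \<kappa> ?d ?d \<le> hi * sqint (S \<times> S) (G ?d)" by (rule form_upper[OF \<kappa> d])
        also have "\<dots> \<le> hi * e"
          using N1[rule_format, of k] hi sqint_nonneg[of S ?d]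
          by (intro mult_left_mono) (auto simp: energy_def k_def)
        finally show "form \<kappa> ?d ?d \<le> hi * e" .
      qed
      finally have 1: "(form \<kappa> (u k) v - form \<kappa> w v)\<^sup>2 \<le> (hi * e) * ?F" .
      have "1 / real (Suc k) \<le> 1 / real (Suc N2)"
        by (intro divide_left_mono) (auto simp: k_def)
      then have "?F * (1 / real (Suc k)) \<le> ?F * e"
        using N2 by (intro mult_left_mono F) linarith
      then have 2: "(form \<kappa> (u k) v - load \<Omega> f v)\<^sup>2 \<le> ?F * e"
        using near[of k] by linarith
      have sq: "(b - c)\<^sup>2 \<le> 2 * (a - b)\<^sup>2 + 2 * (a - c)\<^sup>2" for a b c :: real
        using zero_le_power2[of "2 * a - b - c"] by (simp add: power2_eq_square algebra_simps)
      have "(form \<kappa> w v - load \<Omega> f v)\<^sup>2 \<le>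
          2 * (form \<kappa> (u k) v - form \<kappa> w v)\<^sup>2 + 2 * (form \<kappa> (u k) v - load \<Omega> f v)\<^sup>2"
        by (rule sq)
      also have "\<dots> \<le> 2 * ((hi * e) * ?F) + 2 * (?F * e)" using 1 2 by linarith
      also have "\<dots> = e * (2 * (hi * ?F) + 2 * ?F)" by (simp add: algebra_simps)
      finally show ?thesis .
    qed
    then have "(form \<kappa> w v - load \<Omega> f v)\<^sup>2 \<le> 0" by (rule nonpos_if_le_small_multiples)
    then show "form \<kappa> w v = load \<Omega> f v" by simp
  qed
qed

end

section \<open>Convexity of the compliance in the design\<close>

lemma design_coefficient_eq_sqrt:
  "0 \<le> \<rho> x \<Longrightarrow> 0 \<le> \<rho> y \<Longrightarrow> design_coefficient 1 \<rho> x y = sqrt (\<rho> x) * sqrt (\<rho> y)"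
  by (simp add: design_coefficient_def powr_half_sqrt)

text \<open>
  Concavity of the geometric mean. This is where the exponent \<open>p = 1\<close> matters: for larger \<open>p\<close> the
  coefficient is homogeneous of a degree above one and no longer concave.
\<close>
lemma sqrt_mult_midpoint_concave:
  fixes a b c d :: real
  assumes "0 \<le> a" "0 \<le> b" "0 \<le> c" "0 \<le> d"
  shows "(sqrt a * sqrt c + sqrt b * sqrt d) / 2 \<le> sqrt (1/2 * a + 1/2 * b) * sqrt (1/2 * c + 1/2 * d)"
proof -
  define x where "x = sqrt a"
  define y where "y = sqrt b"
  define z where "z = sqrt c"
  define w where "w = sqrt d"
  have sq: "a = x\<^sup>2" "b = y\<^sup>2" "c = z\<^sup>2" "d = w\<^sup>2" using assms by (auto simp: x_def y_def z_def w_def)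
  have "((x * z + y * w) / 2)\<^sup>2 \<le> (1/2 * x\<^sup>2 + 1/2 * y\<^sup>2) * (1/2 * z\<^sup>2 + 1/2 * w\<^sup>2)"
    using zero_le_power2[of "x * w - y * z"] by (simp add: power2_eq_square field_simps)
  then have "(x * z + y * w) / 2 \<le> sqrt ((1/2 * x\<^sup>2 + 1/2 * y\<^sup>2) * (1/2 * z\<^sup>2 + 1/2 * w\<^sup>2))"
    by (rule real_le_rsqrt)
  then show ?thesis using assms by (simp add: real_sqrt_mult x_def y_def z_def w_def)
qed

locale compliance_problem = nonlocal_domain K \<delta> \<Omega>
  for K :: "real \<Rightarrow> real" and \<delta> :: real and \<Omega> :: "'a::euclidean_space set" +
  fixes f :: "'a \<Rightarrow> real" and \<rho>lo \<rho>hi \<gamma> :: real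
  assumes load_L2: "f \<in> L2_on \<Omega>"
    and bounds: "0 < \<rho>lo" "\<rho>lo < \<rho>hi" "\<rho>lo < \<gamma>"
begin

abbreviation designs :: "('a \<Rightarrow> real) set"
  where "designs \<equiv> admissible_designs \<delta> \<Omega> \<rho>lo \<rho>hi \<gamma>"

abbreviation design_form :: "('a \<Rightarrow> real) \<Rightarrow> ('a \<Rightarrow> real) \<Rightarrow> ('a \<Rightarrow> real) \<Rightarrow> real"
  where "design_form \<rho> \<equiv> form (design_coefficient 1 \<rho>)"

text \<open>
  The designs of compliance at most \<open>t\<close>, by the dual description of the compliance: one
  inequality for each \<open>v\<close>, convex in the design.
\<close>
definition compliance_sublevel :: "real \<Rightarrow> ('a \<Rightarrow> real) set" where
  "compliance_sublevel t =
    {\<rho> \<in> designs. \<forall>v\<in>U0. 2 * load \<Omega> f v - design_form \<rho> v v \<le> t}"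

lemma designs_iff: "\<rho> \<in> designs \<longleftrightarrow> \<rho> \<in> borel_measurable (lebesgue_on S) \<and>
    (AE x in lebesgue_on S. \<rho>lo \<le> \<rho> x \<and> \<rho> x \<le> \<rho>hi) \<and>
    (LINT x|lebesgue_on \<Omega>. \<rho> x) \<le> \<gamma> * measure lebesgue \<Omega>"
proof -
  have "\<exists>C. AE x in lebesgue_on S. \<bar>\<rho> x\<bar> \<le> C"
    if "AE x in lebesgue_on S. \<rho>lo \<le> \<rho> x \<and> \<rho> x \<le> \<rho>hi"
    using that by (intro exI[of _ \<rho>hi]) (rule eventually_mono, use bounds in auto)
  then show ?thesis by (auto simp: admissible_designs_def Linfty_on_def)
qed

lemma AE_domain: "AE x in lebesgue_on S. P x \<Longrightarrow> AE x in lebesgue_on \<Omega>. P x"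
  using sets_lebesgue_S domain_subset_S by (auto simp: AE_restrict_space_iff elim!: eventually_mono)

lemma measurable_domain: "\<rho> \<in> borel_measurable (lebesgue_on S) \<Longrightarrow> \<rho> \<in> borel_measurable (lebesgue_on \<Omega>)"
  by (rule measurable_restrict_mono[OF _ domain_subset_S])

lemma design_integrable: "\<rho> \<in> designs \<Longrightarrow> integrable (lebesgue_on \<Omega>) \<rho>"
proof (rule finite_measure.integrable_const_bound[OF finite_measure_S(2)])
  assume \<rho>: "\<rho> \<in> designs"
  then have "AE x in lebesgue_on \<Omega>. \<rho>lo \<le> \<rho> x \<and> \<rho> x \<le> \<rho>hi"
    by (intro AE_domain) (simp add: designs_iff)
  then show "AE x in lebesgue_on \<Omega>. norm (\<rho> x) \<le> \<rho>hi"
    by (rule eventually_mono) (use bounds in auto)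
qed (auto simp: designs_iff intro: measurable_domain)

lemma design_L2:
  assumes \<rho>: "\<rho> \<in> designs"
  shows "\<rho> \<in> L2_on S" "sqint S \<rho> \<le> \<rho>hi\<^sup>2 * measure (lebesgue_on S) (space (lebesgue_on S))"
proof -
  have m: "(\<lambda>x. (\<rho> x)\<^sup>2) \<in> borel_measurable (lebesgue_on S)"
    using \<rho> by (auto simp: designs_iff)
  have "AE x in lebesgue_on S. \<rho>lo \<le> \<rho> x \<and> \<rho> x \<le> \<rho>hi" using \<rho> by (simp add: designs_iff)
  then have AE: "AE x in lebesgue_on S. norm ((\<rho> x)\<^sup>2) \<le> \<rho>hi\<^sup>2"
    by (rule eventually_mono) (use bounds in \<open>auto intro!: power_mono\<close>)
  have int: "integrable (lebesgue_on S) (\<lambda>x. (\<rho> x)\<^sup>2)"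
    by (rule finite_measure.integrable_const_bound[OF finite_measure_S(1) AE m])
  then show "\<rho> \<in> L2_on S" using \<rho> by (simp add: L2_on_def designs_iff)
  have "sqint S \<rho> \<le> (LINT x|lebesgue_on S. \<rho>hi\<^sup>2)"
    unfolding sqint_def using AE
    by (intro integral_mono_AE int finite_measure.integrable_const[OF finite_measure_S(1)]) auto
  then show "sqint S \<rho> \<le> \<rho>hi\<^sup>2 * measure (lebesgue_on S) (space (lebesgue_on S))"
    by (simp add: mult.commute)
qed

lemma design_AE_pairs:
  assumes "AE x in lebesgue_on S. \<rho>lo \<le> \<rho> x \<and> \<rho> x \<le> \<rho>hi"
  shows "AE z in lebesgue_on (S \<times> S). (\<rho>lo \<le> \<rho> (fst z) \<and> \<rho> (fst z) \<le> \<rho>hi) \<and>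
    (\<rho>lo \<le> \<rho> (snd z) \<and> \<rho> (snd z) \<le> \<rho>hi)"
  using AE_fst_lebesgue_on[OF open_S assms] AE_snd_lebesgue_on[OF open_S assms] by eventually_elim simp

lemma design_coefficient_bounds:
  assumes "\<rho>lo \<le> \<rho> x" "\<rho> x \<le> \<rho>hi" "\<rho>lo \<le> \<rho> y" "\<rho> y \<le> \<rho>hi"
  shows "\<rho>lo \<le> design_coefficient 1 \<rho> x y" "design_coefficient 1 \<rho> x y \<le> \<rho>hi"
proof -
  have eq: "design_coefficient 1 \<rho> x y = sqrt (\<rho> x) * sqrt (\<rho> y)"
    using assms bounds by (intro design_coefficient_eq_sqrt) auto
  have "sqrt \<rho>lo * sqrt \<rho>lo \<le> sqrt (\<rho> x) * sqrt (\<rho> y)"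
    using assms bounds by (intro mult_mono) auto
  then show "\<rho>lo \<le> design_coefficient 1 \<rho> x y" using bounds by (simp add: eq)
  have "sqrt (\<rho> x) * sqrt (\<rho> y) \<le> sqrt \<rho>hi * sqrt \<rho>hi"
    using assms bounds by (intro mult_mono) auto
  then show "design_coefficient 1 \<rho> x y \<le> \<rho>hi" using bounds by (simp add: eq)
qed

lemma design_elliptic:
  assumes \<rho>: "\<rho> \<in> designs"
  shows "elliptic \<rho>lo \<rho>hi (design_coefficient 1 \<rho>)"
  unfolding elliptic_def
proof (intro conjI)
  have [measurable]: "\<rho> \<in> borel_measurable (lebesgue_on S)" using \<rho> by (simp add: designs_iff)
  show "(\<lambda>z. design_coefficient 1 \<rho> (fst z) (snd z)) \<in> borel_measurable (lebesgue_on (S \<times> S))"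
    unfolding design_coefficient_def by measurable
  have "AE x in lebesgue_on S. \<rho>lo \<le> \<rho> x \<and> \<rho> x \<le> \<rho>hi" using \<rho> by (simp add: designs_iff)
  from design_AE_pairs[OF this]
  show "AE z in lebesgue_on (S \<times> S). \<rho>lo \<le> design_coefficient 1 \<rho> (fst z) (snd z) \<and>
      design_coefficient 1 \<rho> (fst z) (snd z) \<le> \<rho>hi"
    by eventually_elim (simp add: design_coefficient_bounds)
qed (use bounds in auto)

lemma design_form_midpoint_concave:
  assumes \<rho>: "\<rho> \<in> designs" and \<sigma>: "\<sigma> \<in> designs"
    and mid: "(\<lambda>x. 1/2 * \<rho> x + 1/2 * \<sigma> x) \<in> designs" and v: "v \<in> U0"
  shows "(design_form \<rho> v v + design_form \<sigma> v v) / 2 \<le>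
    design_form (\<lambda>x. 1/2 * \<rho> x + 1/2 * \<sigma> x) v v"
proof -
  let ?\<mu> = "\<lambda>x. 1/2 * \<rho> x + 1/2 * \<sigma> x"
  have vU: "v \<in> U" by (rule energy_space_0_subset[OF v])
  note int = form_integrable[OF design_elliptic vU vU]
  have "(design_form \<rho> v v + design_form \<sigma> v v) / 2 =
      (LINT z|lebesgue_on (S \<times> S). 1/2 * form_integrand K (design_coefficient 1 \<rho>) v v z +
        1/2 * form_integrand K (design_coefficient 1 \<sigma>) v v z)"
    using int[OF \<rho>] int[OF \<sigma>] by (simp add: nonlocal_form_def)
  also have "\<dots> \<le> design_form ?\<mu> v v"
    unfolding nonlocal_form_def
  proof (rule integral_mono_AE)
    show "integrable (lebesgue_on (S \<times> S)) (form_integrand K (design_coefficient 1 ?\<mu>) v v)"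
      by (rule int[OF mid])
    show "integrable (lebesgue_on (S \<times> S)) (\<lambda>z. 1/2 * form_integrand K (design_coefficient 1 \<rho>) v v z +
        1/2 * form_integrand K (design_coefficient 1 \<sigma>) v v z)"
      using int[OF \<rho>] int[OF \<sigma>] by auto
    have "AE x in lebesgue_on S. \<rho>lo \<le> \<rho> x \<and> \<rho> x \<le> \<rho>hi"
      "AE x in lebesgue_on S. \<rho>lo \<le> \<sigma> x \<and> \<sigma> x \<le> \<rho>hi"
      using \<rho> \<sigma> by (simp_all add: designs_iff)
    from this[THEN design_AE_pairs]
    show "AE z in lebesgue_on (S \<times> S). 1/2 * form_integrand K (design_coefficient 1 \<rho>) v v z +
        1/2 * form_integrand K (design_coefficient 1 \<sigma>) v v z \<le>
        form_integrand K (design_coefficient 1 ?\<mu>) v v z"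
    proof eventually_elim
      case (elim z)
      obtain x y where z: "z = (x, y)" by force
      have pos: "0 \<le> \<rho> x" "0 \<le> \<sigma> x" "0 \<le> \<rho> y" "0 \<le> \<sigma> y" using elim bounds by (auto simp: z)
      have "1/2 * design_coefficient 1 \<rho> x y + 1/2 * design_coefficient 1 \<sigma> x y \<le>
          design_coefficient 1 ?\<mu> x y"
        using sqrt_mult_midpoint_concave[of "\<rho> x" "\<sigma> x" "\<rho> y" "\<sigma> y"] pos
        by (simp add: design_coefficient_eq_sqrt)
      then have "(1/2 * design_coefficient 1 \<rho> x y + 1/2 * design_coefficient 1 \<sigma> x y) * (G v z * G v z) \<le>
          design_coefficient 1 ?\<mu> x y * (G v z * G v z)"
        by (intro mult_right_mono) auto
      then show ?case by (simp add: form_integrand_eq z algebra_simps)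
    qed
  qed
  finally show ?thesis .
qed

lemma designs_midpoint:
  assumes \<rho>: "\<rho> \<in> designs" and \<sigma>: "\<sigma> \<in> designs"
  shows "(\<lambda>x. 1/2 * \<rho> x + 1/2 * \<sigma> x) \<in> designs"
  unfolding designs_iff
proof (intro conjI)
  have AE: "AE x in lebesgue_on S. \<rho>lo \<le> \<rho> x \<and> \<rho> x \<le> \<rho>hi"
      "AE x in lebesgue_on S. \<rho>lo \<le> \<sigma> x \<and> \<sigma> x \<le> \<rho>hi"
    using \<rho> \<sigma> by (simp_all add: designs_iff)
  then show "AE x in lebesgue_on S. \<rho>lo \<le> 1/2 * \<rho> x + 1/2 * \<sigma> x \<and> 1/2 * \<rho> x + 1/2 * \<sigma> x \<le> \<rho>hi"
    by eventually_elim auto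
  have [measurable]: "\<rho> \<in> borel_measurable (lebesgue_on S)" "\<sigma> \<in> borel_measurable (lebesgue_on S)"
    using \<rho> \<sigma> by (simp_all add: designs_iff)
  show "(\<lambda>x. 1/2 * \<rho> x + 1/2 * \<sigma> x) \<in> borel_measurable (lebesgue_on S)" by measurable
  have "(LINT x|lebesgue_on \<Omega>. 1/2 * \<rho> x + 1/2 * \<sigma> x) =
      1/2 * (LINT x|lebesgue_on \<Omega>. \<rho> x) + 1/2 * (LINT x|lebesgue_on \<Omega>. \<sigma> x)"
    using design_integrable \<rho> \<sigma> by simp
  also have "\<dots> \<le> \<gamma> * measure lebesgue \<Omega>"
    using \<rho> \<sigma> by (simp add: designs_iff)
  finally show "(LINT x|lebesgue_on \<Omega>. 1/2 * \<rho> x + 1/2 * \<sigma> x) \<le> \<gamma> * measure lebesgue \<Omega>" .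
qed

lemma compliance_sublevel_midpoint:
  assumes "\<rho> \<in> compliance_sublevel t" "\<sigma> \<in> compliance_sublevel t"
  shows "(\<lambda>x. 1/2 * \<rho> x + 1/2 * \<sigma> x) \<in> compliance_sublevel t"
proof -
  have \<rho>: "\<rho> \<in> designs" "\<sigma> \<in> designs" using assms by (auto simp: compliance_sublevel_def)
  note mid = designs_midpoint[OF \<rho>]
  have "2 * load \<Omega> f v - design_form (\<lambda>x. 1/2 * \<rho> x + 1/2 * \<sigma> x) v v \<le> t" if v: "v \<in> U0" for v
  proof -
    have "2 * load \<Omega> f v - design_form \<rho> v v \<le> t" "2 * load \<Omega> f v - design_form \<sigma> v v \<le> t"
      using assms v by (auto simp: compliance_sublevel_def)
    moreover have "2 * l - c \<le> t" if "2 * l - a \<le> t" "2 * l - b \<le> t" "(a + b) / 2 \<le> c"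
      for a b c l t :: real
    proof -
      have "a + b \<le> 2 * c" using that(3) by simp
      then show ?thesis using that(1,2) by linarith
    qed
    ultimately show ?thesis using design_form_midpoint_concave[OF \<rho> mid v] by blast
  qed
  then show ?thesis using mid by (simp add: compliance_sublevel_def)
qed

text \<open>
  Every inequality defining the sublevel set involves one fixed \<open>v\<close>, and for fixed \<open>v\<close> the
  integrands are dominated by \<open>\<rho>hi\<close> times the squared gradient.
\<close>
lemma compliance_sublevel_limit:
  assumes \<rho>: "\<And>k. \<rho> k \<in> compliance_sublevel (t k)" and t: "t \<longlonglongrightarrow> m"
    and meas: "\<sigma> \<in> borel_measurable (lebesgue_on S)"
    and lim: "AE x in lebesgue_on S. (\<lambda>k. \<rho> k x) \<longlonglongrightarrow> \<sigma> x"
  shows "\<sigma> \<in> compliance_sublevel m"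
proof -
  have des: "\<rho> k \<in> designs" for k using \<rho> by (simp add: compliance_sublevel_def)
  have AE: "AE x in lebesgue_on S. \<rho>lo \<le> \<rho> k x \<and> \<rho> k x \<le> \<rho>hi" for k
    using des by (simp add: designs_iff)
  then have AE_all: "AE x in lebesgue_on S. \<forall>k. \<rho>lo \<le> \<rho> k x \<and> \<rho> k x \<le> \<rho>hi"
    by (simp add: AE_all_countable)
  have AE_\<sigma>: "AE x in lebesgue_on S. \<rho>lo \<le> \<sigma> x \<and> \<sigma> x \<le> \<rho>hi"
    using AE_all lim
  proof eventually_elim
    case (elim x)
    then show ?case
      using LIMSEQ_le_const[OF elim(2), of \<rho>lo] LIMSEQ_le_const2[OF elim(2), of \<rho>hi] by blast
  qed
  have "(\<lambda>k. LINT x|lebesgue_on \<Omega>. \<rho> k x) \<longlonglongrightarrow> (LINT x|lebesgue_on \<Omega>. \<sigma> x)"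
  proof (rule integral_dominated_convergence[where w = "\<lambda>_. \<rho>hi"])
    show "\<sigma> \<in> borel_measurable (lebesgue_on \<Omega>)" by (rule measurable_domain[OF meas])
    show "\<rho> k \<in> borel_measurable (lebesgue_on \<Omega>)" for k
      using des by (intro measurable_domain) (simp add: designs_iff)
    show "integrable (lebesgue_on \<Omega>) (\<lambda>_. \<rho>hi)"
      by (rule finite_measure.integrable_const[OF finite_measure_S(2)])
    show "AE x in lebesgue_on \<Omega>. (\<lambda>k. \<rho> k x) \<longlonglongrightarrow> \<sigma> x" by (rule AE_domain[OF lim])
    show "AE x in lebesgue_on \<Omega>. norm (\<rho> k x) \<le> \<rho>hi" for k
      by (rule eventually_mono[OF AE_domain[OF AE[of k]]]) (use bounds in auto)
  qed
  then have "(LINT x|lebesgue_on \<Omega>. \<sigma> x) \<le> \<gamma> * measure lebesgue \<Omega>"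
    using des by (intro LIMSEQ_le_const2) (auto simp: designs_iff)
  then have \<sigma>: "\<sigma> \<in> designs" using meas AE_\<sigma> by (simp add: designs_iff)
  have "2 * load \<Omega> f v - design_form \<sigma> v v \<le> m" if v: "v \<in> U0" for v
  proof -
    have vU: "v \<in> U" by (rule energy_space_0_subset[OF v])
    note int = form_integrable[OF design_elliptic vU vU]
    have "(\<lambda>k. design_form (\<rho> k) v v) \<longlonglongrightarrow> design_form \<sigma> v v"
      unfolding nonlocal_form_def
    proof (rule integral_dominated_convergence[where w = "\<lambda>z. \<rho>hi * (G v z)\<^sup>2"])
      show "form_integrand K (design_coefficient 1 \<sigma>) v v \<in> borel_measurable (lebesgue_on (S \<times> S))"
        using int[OF \<sigma>] by simp
      show "form_integrand K (design_coefficient 1 (\<rho> k)) v v \<in> borel_measurable (lebesgue_on (S \<times> S))" for k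
        using int[OF des[of k]] by simp
      show "integrable (lebesgue_on (S \<times> S)) (\<lambda>z. \<rho>hi * (G v z)\<^sup>2)"
        using energy_spaceD(2)[OF vU] by (simp add: L2_on_def)
      show "AE z in lebesgue_on (S \<times> S). (\<lambda>k. form_integrand K (design_coefficient 1 (\<rho> k)) v v z)
          \<longlonglongrightarrow> form_integrand K (design_coefficient 1 \<sigma>) v v z"
        using AE_fst_lebesgue_on[OF open_S lim] AE_snd_lebesgue_on[OF open_S lim] design_AE_pairs[OF AE_\<sigma>]
      proof eventually_elim
        case (elim z)
        then show ?case unfolding form_integrand_eq design_coefficient_def
          using bounds by (intro tendsto_mult tendsto_powr tendsto_const) auto
      qed
      show "AE z in lebesgue_on (S \<times> S).
          norm (form_integrand K (design_coefficient 1 (\<rho> k)) v v z) \<le> \<rho>hi * (G v z)\<^sup>2" for k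
        using design_AE_pairs[OF AE[of k]]
      proof eventually_elim
        case (elim z)
        then have "\<bar>design_coefficient 1 (\<rho> k) (fst z) (snd z)\<bar> \<le> \<rho>hi"
          using design_coefficient_bounds[of "\<rho> k" "fst z" "snd z"] bounds by auto
        then show ?case
          by (simp add: form_integrand_eq abs_mult power2_eq_square[symmetric] mult_right_mono)
      qed
    qed
    then have "(\<lambda>k. t k + design_form (\<rho> k) v v) \<longlonglongrightarrow> m + design_form \<sigma> v v"
      by (intro tendsto_add t)
    then have "2 * load \<Omega> f v \<le> m + design_form \<sigma> v v"
    proof (rule LIMSEQ_le_const)
      have "2 * load \<Omega> f v \<le> t k + design_form (\<rho> k) v v" for k
        using \<rho>[of k] v by (auto simp: compliance_sublevel_def algebra_simps)
      then show "\<exists>N. \<forall>k\<ge>N. 2 * load \<Omega> f v \<le> t k + design_form (\<rho> k) v v" by blast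
    qed
    then show ?thesis by simp
  qed
  then show ?thesis using \<sigma> by (simp add: compliance_sublevel_def)
qed

lemma compliance_sublevel_nonempty: "\<exists>t. compliance_sublevel t \<noteq> {}"
proof -
  obtain B where B: "\<And>hi \<kappa> v. elliptic \<rho>lo hi \<kappa> \<Longrightarrow> v \<in> U0 \<Longrightarrow> 2 * load \<Omega> f v - form \<kappa> v v \<le> B"
    using dual_energy_bounded[OF load_L2 bounds(1)] by blast
  have \<rho>: "(\<lambda>_. \<rho>lo) \<in> designs"
    using bounds sets_lebesgue_S(1) mult_right_mono[of \<rho>lo \<gamma> "measure lebesgue \<Omega>"]
    by (simp add: designs_iff measure_restrict_space space_restrict_space mult.commute)
  then have "(\<lambda>_. \<rho>lo) \<in> compliance_sublevel B"
    using B[OF design_elliptic[OF \<rho>]] by (auto simp: compliance_sublevel_def)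
  then show ?thesis by blast
qed

lemma compliance_sublevel_nonneg: "\<rho> \<in> compliance_sublevel t \<Longrightarrow> 0 \<le> t"
  using zero_energy_space_0
  by (auto simp: compliance_sublevel_def nonlocal_form_def form_integrand_def load_def split_def dest!: bspec[of _ _ "\<lambda>_. 0"])

section \<open>Existence of an optimal design\<close>

lemma compliance_sublevel_attained:
  obtains \<rho> m where "\<rho> \<in> compliance_sublevel m" "\<And>\<sigma> t. \<sigma> \<in> compliance_sublevel t \<Longrightarrow> m \<le> t"
proof -
  define T where "T = {t. compliance_sublevel t \<noteq> {}}"
  define m where "m = Inf T"
  have bdd: "bdd_below T"
    using compliance_sublevel_nonneg by (intro bdd_belowI[of _ 0]) (auto simp: T_def)
  have T: "T \<noteq> {}" using compliance_sublevel_nonempty by (auto simp: T_def)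
  have mono: "compliance_sublevel s \<subseteq> compliance_sublevel t" if "s \<le> t" for s t
    using that by (force simp: compliance_sublevel_def)
  \<comment> \<open>All these sets are nonempty, whereas the infimum \<open>m\<close> is not yet known to be attained.\<close>
  define C where "C k = compliance_sublevel (m + 1 / real (Suc k))" for k
  let ?B = "\<rho>hi\<^sup>2 * measure (lebesgue_on S) (space (lebesgue_on S))"
  have L2: "\<rho> \<in> L2_on S" "sqint S \<rho> \<le> ?B" if "\<rho> \<in> C k" for \<rho> k
    using that design_L2[of \<rho>] by (auto simp: C_def compliance_sublevel_def)
  have ne: "C k \<noteq> {}" for k
  proof -
    obtain t where "t \<in> T" "t < m + 1 / real (Suc k)"
      using cInf_lessD[OF T, of "m + 1 / real (Suc k)"] by (auto simp: m_def)
    then show ?thesis using mono[of t "m + 1 / real (Suc k)"] by (auto simp: T_def C_def)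
  qed
  obtain \<rho> :: "nat \<Rightarrow> 'a \<Rightarrow> real" where \<rho>: "\<And>k. \<rho> k \<in> C k"
    and Cauchy: "\<And>\<epsilon>. \<epsilon> > 0 \<Longrightarrow> \<exists>N. \<forall>j\<ge>N. \<forall>k\<ge>N. sqint S (\<lambda>x. \<rho> j x - \<rho> k x) / 4 < \<epsilon>"
  proof (rule midpoint_minimizing_sequence[of C 0 "sqint S" ?B
        "\<lambda>\<rho> \<sigma> x. 1/2 * \<rho> x + 1/2 * \<sigma> x" "\<lambda>\<rho> \<sigma>. sqint S (\<lambda>x. \<rho> x - \<sigma> x) / 4"])
    show "C k \<subseteq> C j" if "j \<le> k" for j k
      unfolding C_def using that by (intro mono add_left_mono divide_left_mono) auto
    show "\<exists>\<rho>\<in>C k. sqint S \<rho> \<le> ?B" for k using ne[of k] L2 by blast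
    show "(\<lambda>x. 1/2 * \<rho> x + 1/2 * \<sigma> x) \<in> C k" if "\<rho> \<in> C k" "\<sigma> \<in> C k" for \<rho> \<sigma> k
      using compliance_sublevel_midpoint that unfolding C_def by blast
    show "sqint S (\<lambda>x. \<rho> x - \<sigma> x) / 4 \<le>
        (sqint S \<rho> + sqint S \<sigma>) / 2 - sqint S (\<lambda>x. 1/2 * \<rho> x + 1/2 * \<sigma> x)"
      if "\<rho> \<in> C 0" "\<sigma> \<in> C 0" for \<rho> \<sigma>
    proof -
      note l = sqint_lincomb[OF L2(1)[OF that(1)] L2(1)[OF that(2)]]
      have "sqint S (\<lambda>x. \<rho> x - \<sigma> x) =
          sqint S \<rho> - 2 * (LINT x|lebesgue_on S. \<rho> x * \<sigma> x) + sqint S \<sigma>"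
        using l[of 1 "-1"] by simp
      then show ?thesis unfolding l by (simp add: power2_eq_square field_simps)
    qed
  qed (auto simp: sqint_nonneg)
  have "\<exists>N. \<forall>j\<ge>N. \<forall>k\<ge>N. sqint S (\<lambda>x. \<rho> j x - \<rho> k x) < \<epsilon>" if "\<epsilon> > 0" for \<epsilon>
    using Cauchy[of "\<epsilon> / 4"] that by simp
  from L2_on_Cauchy_AE_subseq[OF L2(1)[OF \<rho>] this]
  obtain r \<sigma> where r: "strict_mono r" and \<sigma>: "\<sigma> \<in> borel_measurable (lebesgue_on S)"
    "AE x in lebesgue_on S. (\<lambda>i. \<rho> (r i) x) \<longlonglongrightarrow> \<sigma> x" by blast
  have "(\<lambda>k. m + 1 / real (Suc k)) \<longlonglongrightarrow> m + 0"
    by (intro tendsto_intros LIMSEQ_Suc lim_1_over_n)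
  then have "(\<lambda>i. m + 1 / real (Suc (r i))) \<longlonglongrightarrow> m"
    using LIMSEQ_subseq_LIMSEQ[OF _ r] by (force simp: o_def)
  from compliance_sublevel_limit[OF _ this \<sigma>]
  have \<sigma>m: "\<sigma> \<in> compliance_sublevel m" using \<rho> by (auto simp: C_def)
  show ?thesis
  proof
    show "\<sigma> \<in> compliance_sublevel m" by (rule \<sigma>m)
    show "m \<le> t" if "\<sigma> \<in> compliance_sublevel t" for \<sigma> t
      unfolding m_def using that by (intro cInf_lower bdd) (auto simp: T_def)
  qed
qed

lemma feasible_iff:
  "(\<rho>, u) \<in> feasible_pairs K \<delta> \<Omega> f 1 \<rho>lo \<rho>hi \<gamma> \<longleftrightarrow>
    \<rho> \<in> designs \<and> u \<in> U0 \<and> (\<forall>v\<in>U0. design_form \<rho> u v = load \<Omega> f v)"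
  by (simp add: feasible_pairs_def)

text \<open>Expand \<open>a\<^sub>\<rho>(u - v, u - v) \<ge> 0\<close> and use the state equation for \<open>u\<close> twice.\<close>
lemma feasible_in_sublevel:
  assumes "(\<rho>, u) \<in> feasible_pairs K \<delta> \<Omega> f 1 \<rho>lo \<rho>hi \<gamma>"
  shows "\<rho> \<in> compliance_sublevel (load \<Omega> f u)"
proof -
  have \<rho>: "\<rho> \<in> designs" and u: "u \<in> U0" and eq: "\<And>v. v \<in> U0 \<Longrightarrow> design_form \<rho> u v = load \<Omega> f v"
    using assms by (auto simp: feasible_iff)
  note \<kappa> = design_elliptic[OF \<rho>]
  have "2 * load \<Omega> f v - design_form \<rho> v v \<le> load \<Omega> f u" if v: "v \<in> U0" for v
  proof -
    note U = energy_space_0_subset[OF u] energy_space_0_subset[OF v]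
    have "0 \<le> design_form \<rho> (\<lambda>x. 1 * u x + (-1) * v x) (\<lambda>x. 1 * u x + (-1) * v x)"
      by (rule form_nonneg[OF \<kappa> energy_space_lincomb[OF U]])
    then show ?thesis
      unfolding form_lincomb_square[OF \<kappa> U] by (simp add: eq u v)
  qed
  then show ?thesis using \<rho> by (simp add: compliance_sublevel_def)
qed

theorem optimal_solution_exists: "\<exists>\<rho> u. optimal_solution K \<delta> \<Omega> f 1 \<rho>lo \<rho>hi \<gamma> \<rho> u"
proof -
  obtain \<rho> m where \<rho>: "\<rho> \<in> compliance_sublevel m"
    and m: "\<And>\<sigma> t. \<sigma> \<in> compliance_sublevel t \<Longrightarrow> m \<le> t"
    using compliance_sublevel_attained by blast
  have des: "\<rho> \<in> designs" using \<rho> by (simp add: compliance_sublevel_def)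
  obtain u where u: "u \<in> U0" "\<And>v. v \<in> U0 \<Longrightarrow> design_form \<rho> u v = load \<Omega> f v"
    using state_equation_solvable[OF design_elliptic[OF des] load_L2] by blast
  have feasible: "(\<rho>, u) \<in> feasible_pairs K \<delta> \<Omega> f 1 \<rho>lo \<rho>hi \<gamma>"
    using des u by (simp add: feasible_iff)
  have "2 * load \<Omega> f u - design_form \<rho> u u \<le> m"
    using \<rho> u(1) by (simp add: compliance_sublevel_def)
  then have "load \<Omega> f u \<le> m" by (simp add: u)
  then have "load \<Omega> f u \<le> load \<Omega> f u'"
    if "(\<rho>', u') \<in> feasible_pairs K \<delta> \<Omega> f 1 \<rho>lo \<rho>hi \<gamma>" for \<rho>' u'
    using m[OF feasible_in_sublevel[OF that]] by linarith
  then have "optimal_solution K \<delta> \<Omega> f 1 \<rho>lo \<rho>hi \<gamma> \<rho> u"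
    using feasible unfolding optimal_solution_def by blast
  then show ?thesis by blast
qed

end

text \<open>
  As \<open>e\<close> is nonnegative, the power of the norm is smallest at the outer radius, and dividing
  by the squared norm preserves this.
\<close>
lemma kernel_quotient_bounded_below:
  fixes k :: "real \<Rightarrow> real" and \<delta> c e :: real
  assumes lower: "\<forall>x\<in>ball (0::'a::euclidean_space) (\<delta> / 2) - {0}. k (norm x) \<ge> c * norm x powr (- e)"
    and "c > 0" "e \<ge> 0" "\<delta> > 0"
  shows "\<exists>c>0. \<forall>h::'a. \<delta> / 4 \<le> norm h \<longrightarrow> norm h < \<delta> / 2 \<longrightarrow> c \<le> k (norm h) / (norm h)\<^sup>2"
proof (intro exI conjI allI impI)
  let ?c = "c * (\<delta> / 2) powr (- e) / (\<delta> / 2)\<^sup>2"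
  show "?c > 0" using assms by simp
  fix h :: 'a assume h: "\<delta> / 4 \<le> norm h" "norm h < \<delta> / 2"
  then have h0: "norm h > 0" using \<open>\<delta> > 0\<close> by linarith
  have "c * (\<delta> / 2) powr (- e) \<le> c * norm h powr (- e)"
    using assms h h0 by (intro mult_left_mono powr_mono2') auto
  also have "\<dots> \<le> k (norm h)" using lower h h0 by auto
  finally have k: "c * (\<delta> / 2) powr (- e) \<le> k (norm h)" .
  have "0 \<le> c * (\<delta> / 2) powr (- e)" using assms by simp
  then show "?c \<le> k (norm h) / (norm h)\<^sup>2"
    using k h h0 by (intro frac_le power_mono) auto
qed

theorem proposition4:
  fixes \<Omega> :: "'a::euclidean_space set"
    and A :: "real \<Rightarrow> real \<Rightarrow> real"
    and f :: "'a \<Rightarrow> real"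
    and \<delta> p \<rho>lo \<rho>hi \<gamma> :: real
  assumes dim: "DIM('a) \<ge> 2"
    and domain: "open \<Omega>" "bounded \<Omega>" "connected \<Omega>"
    and kernel_nonneg: "\<And>d r. d > 0 \<Longrightarrow> r \<ge> 0 \<Longrightarrow> A d r \<ge> 0"
    and kernel_integrable: "\<And>d. d > 0 \<Longrightarrow> integrable lebesgue (\<lambda>x::'a. A d (norm x))"
    and kernel_normalized:
      "\<And>d. d > 0 \<Longrightarrow> 1 / real DIM('a) * (LINT x|lebesgue. A d (norm (x::'a))) = 1"
    and kernel_support: "\<And>d. d > 0 \<Longrightarrow> closure {x::'a. A d (norm x) \<noteq> 0} \<subseteq> ball 0 d"
    and kernel_lower_bound:
      "\<exists>s c. 0 < s \<and> s < 1 \<and> (\<forall>d>0. c d > 0 \<and>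
         (\<forall>x\<in>ball (0::'a) (d / 2) - {0}.
            A d (norm x) \<ge> c d * norm x powr (- (real DIM('a) + 2 * s - 2))))"
    and bounds: "0 < \<rho>lo" "\<rho>lo < \<rho>hi" "\<rho>lo < \<gamma>" "\<gamma> < \<rho>hi"
    and delta: "\<delta> > 0"
    and load: "f \<in> L2_on \<Omega>"
    and exponent: "p = 1"
  shows "\<exists>\<rho> u. optimal_solution (A \<delta>) \<delta> \<Omega> f p \<rho>lo \<rho>hi \<gamma> \<rho> u"
proof -
  obtain s c where s: "0 < s" and c: "c \<delta> > 0"
    and lower: "\<forall>x\<in>ball (0::'a) (\<delta> / 2) - {0}.
      A \<delta> (norm x) \<ge> c \<delta> * norm x powr (- (real DIM('a) + 2 * s - 2))"
    using kernel_lower_bound delta by blast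
  interpret compliance_problem "A \<delta>" \<delta> \<Omega> f \<rho>lo \<rho>hi \<gamma>
  proof
    show "\<exists>c>0. \<forall>h::'a. \<delta> / 4 \<le> norm h \<longrightarrow> norm h < \<delta> / 2 \<longrightarrow> c \<le> A \<delta> (norm h) / (norm h)\<^sup>2"
      using dim s by (intro kernel_quotient_bounded_below[OF lower c _ delta]) simp
  qed (use assms in auto)
  show ?thesis unfolding exponent by (rule optimal_solution_exists)
qed

end
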